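(* For nonnegative integers $m,n$, let $S_{m,n}\subset\mathbb{C}$ be a configuration of $m+2$ points on the segment $[-1,1]$ including both endpoints $-1$ and $1$, together with $n$ points on the open upper half of the unit circle $\{e^{i\theta}:0<\theta<\pi\}$. Then $\textsc{NC}(S_{m,n})$ admits a symmetric chain decomposition.
   Context: For a finite set $P\subset\mathbb{C}$, a partition of $P$ is noncrossing if the convex hulls of its blocks are pairwise disjoint; $\textsc{NC}(P)$ is the set of noncrossing partitions of $P$ ordered by refinement ($\pi\le\mu$ iff every block of $\mu$ is a union of blocks of $\pi$). $\textsc{NC}(P)$ is graded with rank function $\rho(\pi)=|P|-(\text{number of blocks of }\pi)$, so the maximum has rank $|P|-1$. A chain $c_1<\dots<c_k$ is saturated if each $c_{i+1}$ covers $c_i$, and centered if $\rho(c_1)+\rho(c_k)=|P|-1$. A symmetric chain decomposition is a partition of the poset's elements into disjoint saturated centered chains. *)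

theory Defs
  imports "HOL-Analysis.Analysis" "HOL-Library.Disjoint_Sets"
begin

definition NC :: "complex set \<Rightarrow> complex set set set" where
  "NC P = {\<pi>. partition_on P \<pi> \<and> disjoint_family_on (\<lambda>B. convex hull B) \<pi>}"

definition nc_le :: "complex set set \<Rightarrow> complex set set \<Rightarrow> bool" where
  "nc_le \<pi> \<mu> \<longleftrightarrow> (\<forall>B\<in>\<mu>. \<exists>\<B>\<subseteq>\<pi>. B = \<Union>\<B>)"

definition nc_less :: "complex set set \<Rightarrow> complex set set \<Rightarrow> bool" where
  "nc_less \<pi> \<mu> \<longleftrightarrow> nc_le \<pi> \<mu> \<and> \<pi> \<noteq> \<mu>"

lemma nc_le_iff_refines:
  assumes "partition_on P \<pi>" and "partition_on P \<mu>"
  shows "nc_le \<pi> \<mu> \<longleftrightarrow> refines P \<pi> \<mu>"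
proof
  assume le: "nc_le \<pi> \<mu>"
  have "\<exists>B\<in>\<mu>. X \<subseteq> B" if X: "X \<in> \<pi>" for X
  proof -
    obtain x where x: "x \<in> X"
      using assms(1) X by (metis all_not_in_conv partition_onD3)
    then obtain B where B: "B \<in> \<mu>" "x \<in> B"
      using assms X by (metis Union_iff partition_onD1)
    then obtain \<B> where C: "\<B> \<subseteq> \<pi>" "B = \<Union>\<B>"
      using le unfolding nc_le_def by blast
    then obtain Y where Y: "Y \<in> \<B>" "x \<in> Y"
      using B by blast
    then have "Y = X"
      using x X C(1) partition_onD2[OF assms(1)] unfolding disjoint_def by blast
    then show ?thesis
      using B C Y by blast
  qed
  then show "refines P \<pi> \<mu>"
    using assms unfolding refines_def by blast
next
  assume r: "refines P \<pi> \<mu>"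
  show "nc_le \<pi> \<mu>"
    unfolding nc_le_def
  proof
    fix B assume B: "B \<in> \<mu>"
    have "x \<in> \<Union>{X\<in>\<pi>. X \<subseteq> B}" if x: "x \<in> B" for x
    proof -
      obtain X where X: "X \<in> \<pi>" "x \<in> X"
        using assms B x by (metis Union_iff partition_onD1)
      then obtain Y where Y: "Y \<in> \<mu>" "X \<subseteq> Y"
        using r unfolding refines_def by blast
      then have "Y = B"
        using x X B partition_onD2[OF assms(2)] unfolding disjoint_def by blast
      then show ?thesis
        using X Y by blast
    qed
    then have "B = \<Union>{X\<in>\<pi>. X \<subseteq> B}"
      by blast
    then show "\<exists>\<B>\<subseteq>\<pi>. B = \<Union>\<B>"
      by (metis (no_types, lifting) mem_Collect_eq subsetI)
  qed
qed

definition nc_covers :: "complex set \<Rightarrow> complex set set \<Rightarrow> complex set set \<Rightarrow> bool" where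
  "nc_covers P \<pi> \<mu> \<longleftrightarrow> \<pi> \<in> NC P \<and> \<mu> \<in> NC P \<and> nc_less \<pi> \<mu> \<and>
     \<not> (\<exists>\<sigma>\<in>NC P. nc_less \<pi> \<sigma> \<and> nc_less \<sigma> \<mu>)"

text \<open>Ranks are integers, to avoid truncated subtraction.\<close>

definition nc_rank :: "complex set \<Rightarrow> complex set set \<Rightarrow> int" where
  "nc_rank P \<pi> = int (card P) - int (card \<pi>)"

text \<open>A chain \<open>c\<^sub>1 < \<dots> < c\<^sub>k\<close> is represented by the nonempty list of its elements
  in increasing order.\<close>

definition nc_chain :: "complex set \<Rightarrow> complex set set list \<Rightarrow> bool" where
  "nc_chain P cs \<longleftrightarrow> cs \<noteq> [] \<and> set cs \<subseteq> NC P \<and> sorted_wrt nc_less cs"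

definition saturated :: "complex set \<Rightarrow> complex set set list \<Rightarrow> bool" where
  "saturated P cs \<longleftrightarrow> nc_chain P cs \<and> successively (nc_covers P) cs"

definition centered :: "complex set \<Rightarrow> complex set set list \<Rightarrow> bool" where
  "centered P cs \<longleftrightarrow> nc_chain P cs \<and>
     nc_rank P (hd cs) + nc_rank P (last cs) = int (card P) - 1"

definition symmetric_chain_decomposition ::
    "complex set \<Rightarrow> complex set set set set \<Rightarrow> bool" where
  "symmetric_chain_decomposition P \<D> \<longleftrightarrow> partition_on (NC P) \<D> \<and>
     (\<forall>C\<in>\<D>. \<exists>cs. set cs = C \<and> saturated P cs \<and> centered P cs)"

end

theory Submission
  imports Defs
begin

text \<open>Walk along the boundary of the half disk, first the diameter and then the arc. In this linear
  order two blocks have disjoint convex hulls iff they do not interleave and neither separates two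
  points of the other on the diameter. Let \<open>a\<close> be the first point and sort the noncrossing partitions by
  the successor of \<open>a\<close> in its block: each class is a product of two smaller instances, except that the
  class where \<open>a\<close> is a singleton has to be merged with the one where the successor is the second point,
  which gives a product with a two-element chain. All these products have the same rank centre as the
  whole poset, and symmetric chain decompositions pass to products.\<close>

text \<open>Take minus the number of blocks as rank and call the sum of the two end ranks of a chain
  its centre. Over a nonempty set \<open>S\<close> the ranks run from -|S| to -1, so every chain
  must have centre -|S| - 1. If \<open>j\<close> is the successor of \<open>a\<close>, let
  \<open>X\<close> be the points strictly between them and \<open>Z\<close> those from
  \<open>j\<close> on. Since |S| = |X| + |Z| + 1, the product over \<open>X\<close> and
  \<open>Z\<close> has centre (-|X| - 1) + (-|Z| - 1) = -|S| - 1, as wanted.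

  The obstacle is an empty \<open>X\<close>: its only partition is empty and has rank 0, so the
  formula for the centre fails. With \<open>j\<close> the second point the class is therefore
  centred at -|S|, one too high. The class where \<open>a\<close> is a singleton is another copy of
  the partitions of \<open>S\<close> without \<open>a\<close>, with one block more, and is centred
  at -|S| - 2, one too low. Pairing the copies along a two-element chain restores the centre.

  The diameter only removes classes: if \<open>j\<close> lies on it beyond the second point, the
  second point separates \<open>a\<close> from \<open>j\<close> and the class is empty. In the
  remaining classes with nonempty \<open>X\<close>, \<open>j\<close> is on the arc, and
  \<open>X\<close> and \<open>Z\<close> do not constrain each other.\<close>

section \<open>Symmetric chain decompositions: unions, images and products\<close>

text \<open>Saturation is encoded as a rank step of one along an arbitrary relation
  \<open>R\<close>, a form that passes directly to images and products. For refinement the rank is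
  strictly monotone, and such a step is then a cover.\<close>

definition symmetric_chain :: "('a \<Rightarrow> 'a \<Rightarrow> bool) \<Rightarrow> ('a \<Rightarrow> int) \<Rightarrow> int \<Rightarrow> 'a set \<Rightarrow> bool" where
  "symmetric_chain R r N C \<longleftrightarrow> (\<exists>cs. cs \<noteq> [] \<and> set cs = C \<and>
     successively (\<lambda>x y. R x y \<and> r y = r x + 1) cs \<and> r (hd cs) + r (last cs) = N)"

definition scd :: "'a set \<Rightarrow> ('a \<Rightarrow> 'a \<Rightarrow> bool) \<Rightarrow> ('a \<Rightarrow> int) \<Rightarrow> int \<Rightarrow> bool" where
  "scd X R r N \<longleftrightarrow> (\<exists>\<D>. partition_on X \<D> \<and> (\<forall>C\<in>\<D>. symmetric_chain R r N C))"

lemma scd_empty: "scd {} R r N"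
  unfolding scd_def by (rule exI[of _ "{}"]) (simp add: partition_on_empty)

lemma scdE:
  assumes "scd X R r N"
  obtains D where "partition_on X D" "\<And>C. C \<in> D \<Longrightarrow> symmetric_chain R r N C"
  using assms unfolding scd_def by auto

lemma symmetric_chainE:
  assumes "symmetric_chain R r N C"
  obtains cs where "cs \<noteq> []" "set cs = C" "successively (\<lambda>x y. R x y \<and> r y = r x + 1) cs"
    "r (hd cs) + r (last cs) = N"
  using assms unfolding symmetric_chain_def by auto

lemma scd_chain:
  assumes "cs \<noteq> []" "successively (\<lambda>x y. R x y \<and> r y = r x + 1) cs" "r (hd cs) + r (last cs) = N"
  shows "scd (set cs) R r N"
  unfolding scd_def symmetric_chain_def
  by (rule exI[of _ "{set cs}"]) (use assms in \<open>auto intro!: partition_on_space\<close>)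

lemma scd_UN:
  assumes "\<And>i. i \<in> I \<Longrightarrow> scd (X i) R r N" and "disjoint_family_on X I"
  shows "scd (\<Union>i\<in>I. X i) R r N"
proof -
  have "\<exists>D. \<forall>i\<in>I. partition_on (X i) (D i) \<and> (\<forall>C\<in>D i. symmetric_chain R r N C)"
    using assms(1) unfolding scd_def by (intro bchoice ballI)
  then obtain D where D: "\<And>i. i \<in> I \<Longrightarrow> partition_on (X i) (D i)"
    and ch: "\<And>i C. i \<in> I \<Longrightarrow> C \<in> D i \<Longrightarrow> symmetric_chain R r N C"
    by blast
  have "partition_on (\<Union>i\<in>I. X i) (\<Union>i\<in>I. D i)"
  proof (rule partition_onI)
    show "\<Union> (\<Union>i\<in>I. D i) = (\<Union>i\<in>I. X i)"
      using partition_onD1[OF D] by blast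
    show "{} \<notin> (\<Union>i\<in>I. D i)"
      using partition_onD3[OF D] by blast
    show "disjnt p q" if pq: "p \<in> (\<Union>i\<in>I. D i)" "q \<in> (\<Union>i\<in>I. D i)" "p \<noteq> q" for p q
    proof -
      obtain i j where ij: "i \<in> I" "j \<in> I" "p \<in> D i" "q \<in> D j"
        using pq by blast
      show ?thesis
      proof (cases "i = j")
        case True
        then show ?thesis
          using ij pq(3) partition_onD2[OF D] by (auto simp: disjoint_def disjnt_def)
      next
        case False
        then have "X i \<inter> X j = {}"
          using assms(2) ij by (auto simp: disjoint_family_on_def)
        moreover have "p \<subseteq> X i" "q \<subseteq> X j"
          using ij partition_onD1[OF D] by blast+
        ultimately show ?thesis
          by (auto simp: disjnt_def)
      qed
    qed
  qed
  then show ?thesis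
    unfolding scd_def using ch by (intro exI[of _ "\<Union>i\<in>I. D i"]) blast
qed

lemma scd_Un:
  assumes "scd X R r N" "scd Y R r N" "X \<inter> Y = {}"
  shows "scd (X \<union> Y) R r N"
proof -
  have "scd (\<Union>i\<in>{False, True}. if i then Y else X) R r N"
    using assms by (intro scd_UN) (auto simp: disjoint_family_on_def)
  then show ?thesis
    by (simp add: Un_commute)
qed

text \<open>Chains are transported element by element. Both end ranks move by \<open>c\<close>,
  hence the shift of the centre by \<open>2 * c\<close>.\<close>

lemma scd_image:
  assumes "scd X R r N" and f: "bij_betw f X Y"
    and mono: "\<And>x y. x \<in> X \<Longrightarrow> y \<in> X \<Longrightarrow> R x y \<Longrightarrow> R' (f x) (f y)"
    and rank: "\<And>x. x \<in> X \<Longrightarrow> r' (f x) = r x + c"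
  shows "scd Y R' r' (N + 2 * c)"
proof -
  obtain D where D: "partition_on X D"
    and ch: "\<And>C. C \<in> D \<Longrightarrow> symmetric_chain R r N C"
    by (rule scdE[OF assms(1)], rule that)
  have "f ` X = Y" "inj_on f X"
    using f by (auto simp: bij_betw_def)
  then have "partition_on Y ((`) f ` D)"
    using partition_on_inj_image[OF D, of f] partition_onD3[OF D]
    by (metis (no_types, lifting) Diff_empty Diff_insert0 image_iff image_is_empty)
  moreover have "symmetric_chain R' r' (N + 2 * c) (f ` C)"
    if C: "C \<in> D" for C
  proof -
    obtain cs where cs: "cs \<noteq> []" "set cs = C"
      "successively (\<lambda>x y. R x y \<and> r y = r x + 1) cs" "r (hd cs) + r (last cs) = N"
      by (rule symmetric_chainE[OF ch[OF C]])
    have sub: "set cs \<subseteq> X"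
      using cs C partition_onD1[OF D] by blast
    have "successively (\<lambda>x y. R' x y \<and> r' y = r' x + 1) (map f cs)"
      unfolding successively_map
      by (rule successively_mono[OF cs(3)]) (use sub mono rank in \<open>simp add: subset_iff\<close>)
    moreover have "r' (hd (map f cs)) + r' (last (map f cs)) = N + 2 * c"
      using cs(1,4) rank[of "hd cs"] rank[of "last cs"] subsetD[OF sub, of "hd cs"] subsetD[OF sub, of "last cs"]
      by (simp add: hd_map last_map)
    ultimately show ?thesis
      unfolding symmetric_chain_def using cs by (intro exI[of _ "map f cs"]) simp
  qed
  ultimately show ?thesis
    unfolding scd_def by (intro exI[of _ "(`) f ` D"]) blast
qed

text \<open>Serves to see that an element one rank above the last or below the first entry of a
  chain does not occur in it; this keeps the pieces of a grid disjoint.\<close>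

lemma successively_rank_bounds:
  fixes r :: "'a \<Rightarrow> int"
  assumes "successively (\<lambda>x y. R x y \<and> r y = r x + 1) xs"
  shows "\<forall>x\<in>set xs. r (hd xs) \<le> r x \<and> r x \<le> r (last xs)"
  using assms
proof (induction xs)
  case (Cons y ys)
  show ?case
  proof (cases "ys = []")
    case False
    then have s: "successively (\<lambda>x y. R x y \<and> r y = r x + 1) ys" and r: "r (hd ys) = r y + 1"
      using Cons.prems by (simp_all add: successively_Cons)
    have IH: "r (hd ys) \<le> r x \<and> r x \<le> r (last ys)" if "x \<in> set ys" for x
      using Cons.IH[OF s] that by blast
    show ?thesis
    proof
      fix x assume "x \<in> set (y # ys)"
      then consider "x = y" | "x \<in> set ys"
        by auto
      then show "r (hd (y # ys)) \<le> r x \<and> r x \<le> r (last (y # ys))"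
      proof cases
        case 1
        then show ?thesis
          using False r IH[OF hd_in_set[OF False]] by (simp del: hd_in_set)
      next
        case 2
        then show ?thesis
          using False r IH[OF 2] by simp
      qed
    qed
  qed simp
qed simp

text \<open>The first row and the last column of the grid form one symmetric chain; what remains is the
  grid of two shorter chains.\<close>

lemma scd_chain_prod:
  assumes "successively (\<lambda>x y. R x y \<and> r y = r x + 1) xs"
    and "successively (\<lambda>x y. R' x y \<and> r' y = r' x + 1) ys"
    and "xs \<noteq> [] \<Longrightarrow> r (hd xs) + r (last xs) = N"
    and "ys \<noteq> [] \<Longrightarrow> r' (hd ys) + r' (last ys) = M"
    and "\<And>x. R x x" "\<And>y. R' y y"
  shows "scd (set xs \<times> set ys) (\<lambda>p q. R (fst p) (fst q) \<and> R' (snd p) (snd q))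
           (\<lambda>p. r (fst p) + r' (snd p)) (N + M)"
  using assms
proof (induction xs arbitrary: ys N M rule: rev_induct)
  case Nil
  then show ?case by (simp add: scd_empty)
next
  case (snoc x xs)
  show ?case
  proof (cases ys)
    case Nil
    then show ?thesis by (simp add: scd_empty)
  next
    case (Cons y zs)
    let ?R = "\<lambda>p q. R (fst p) (fst q) \<and> R' (snd p) (snd q)"
    let ?r = "\<lambda>p. r (fst p) + r' (snd p)"
    \<comment> \<open>The path runs through all pairs with second entry \<open>y\<close>, turns at
      the corner \<open>(x, y)\<close>, and continues with first entry \<open>x\<close>. It joins
      the bottom of the grid to its top, so its centre is \<open>N + M\<close>.\<close>
    let ?L = "map (\<lambda>u. (u, y)) (xs @ [x]) @ map (\<lambda>v. (x, v)) zs"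
    have xs: "successively (\<lambda>x y. R x y \<and> r y = r x + 1) xs"
      using snoc.prems(1) by (simp add: successively_append_iff)
    have zs: "successively (\<lambda>x y. R' x y \<and> r' y = r' x + 1) zs"
      using snoc.prems(2) Cons by (cases zs) auto
    have rx: "R (last xs) x \<and> r x = r (last xs) + 1" if "xs \<noteq> []"
      using snoc.prems(1) that by (simp add: successively_append_iff)
    have ry: "R' y (hd zs) \<and> r' (hd zs) = r' y + 1" if "zs \<noteq> []"
      using snoc.prems(2) that Cons by (simp add: successively_Cons)
    have x: "x \<notin> set xs"
      using successively_rank_bounds[OF xs] rx by (cases "xs = []") fastforce+
    have y: "y \<notin> set zs"
      using successively_rank_bounds[OF zs] ry by (cases "zs = []") fastforce+
    \<comment> \<open>Dropping the top \<open>x\<close> lowers one centre by one, dropping the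
      bottom \<open>y\<close> raises the other by one, so the sum is unchanged. The lists may become
      empty here, which is why the centre conditions are stated for nonempty lists.\<close>
    have "scd (set xs \<times> set zs) ?R ?r ((N - 1) + (M + 1))"
    proof (rule snoc.IH[OF xs zs])
      show "r (hd xs) + r (last xs) = N - 1" if "xs \<noteq> []"
        using snoc.prems(3) rx that by simp
      show "r' (hd zs) + r' (last zs) = M + 1" if "zs \<noteq> []"
        using snoc.prems(4) ry that Cons by simp
    qed (use snoc.prems(5,6) in simp_all)
    moreover have "scd (set ?L) ?R ?r (N + M)"
    proof (rule scd_chain)
      have "successively (\<lambda>p q. ?R p q \<and> ?r q = ?r p + 1) (map (\<lambda>u. (u, y)) (xs @ [x]))"
        unfolding successively_map
        by (rule successively_mono[OF snoc.prems(1)]) (use snoc.prems(5,6) in simp)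
      moreover have "successively (\<lambda>p q. ?R p q \<and> ?r q = ?r p + 1) (map (\<lambda>v. (x, v)) zs)"
        unfolding successively_map
        by (rule successively_mono[OF zs]) (use snoc.prems(5,6) in simp)
      ultimately show "successively (\<lambda>p q. ?R p q \<and> ?r q = ?r p + 1) ?L"
        unfolding successively_append_iff using snoc.prems(5) ry by (cases "zs = []") (simp_all add: hd_map)
      show "?r (hd ?L) + ?r (last ?L) = N + M"
        using snoc.prems(3,4) Cons by (cases xs; cases "zs = []") (auto simp: last_map)
    qed simp
    moreover have "set (xs @ [x]) \<times> set ys = set ?L \<union> set xs \<times> set zs"
      using Cons by auto
    moreover have "set ?L \<inter> set xs \<times> set zs = {}"
      using x y by auto
    ultimately show ?thesis
      using scd_Un[of "set ?L" ?R ?r "N + M" "set xs \<times> set zs"] by simp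
  qed
qed

text \<open>The products of a chain of \<open>X\<close> with a chain of \<open>Y\<close> partition
  the whole product into grids, each of which decomposes with the same centre.\<close>

lemma scd_prod:
  assumes "scd X R r N" "scd Y R' r' M" "\<And>x. R x x" "\<And>y. R' y y"
  shows "scd (X \<times> Y) (\<lambda>p q. R (fst p) (fst q) \<and> R' (snd p) (snd q))
           (\<lambda>p. r (fst p) + r' (snd p)) (N + M)"
proof -
  obtain D where D: "partition_on X D"
    and chD: "\<And>C. C \<in> D \<Longrightarrow> symmetric_chain R r N C"
    by (rule scdE[OF assms(1)], rule that)
  obtain E where E: "partition_on Y E"
    and chE: "\<And>C. C \<in> E \<Longrightarrow> symmetric_chain R' r' M C"
    by (rule scdE[OF assms(2)], rule that)
  have "scd (\<Union>p\<in>D \<times> E. fst p \<times> snd p) (\<lambda>p q. R (fst p) (fst q) \<and> R' (snd p) (snd q))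
           (\<lambda>p. r (fst p) + r' (snd p)) (N + M)"
  proof (rule scd_UN)
    fix p assume p: "p \<in> D \<times> E"
    obtain xs where xs: "xs \<noteq> []" "set xs = fst p" "successively (\<lambda>x y. R x y \<and> r y = r x + 1) xs"
      "r (hd xs) + r (last xs) = N"
      by (rule symmetric_chainE[OF chD[OF mem_Times_iff[THEN iffD1, THEN conjunct1, OF p]]])
    obtain ys where ys: "ys \<noteq> []" "set ys = snd p" "successively (\<lambda>x y. R' x y \<and> r' y = r' x + 1) ys"
      "r' (hd ys) + r' (last ys) = M"
      by (rule symmetric_chainE[OF chE[OF mem_Times_iff[THEN iffD1, THEN conjunct2, OF p]]])
    show "scd (fst p \<times> snd p) (\<lambda>p q. R (fst p) (fst q) \<and> R' (snd p) (snd q))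
           (\<lambda>p. r (fst p) + r' (snd p)) (N + M)"
      using scd_chain_prod[OF xs(3) ys(3) xs(4) ys(4) assms(3,4)] xs(2) ys(2) by simp
  next
    show "disjoint_family_on (\<lambda>p. fst p \<times> snd p) (D \<times> E)"
      unfolding disjoint_family_on_def
    proof (intro ballI impI)
      fix p q assume pq: "p \<in> D \<times> E" "q \<in> D \<times> E" "p \<noteq> q"
      then have "fst p \<inter> fst q = {} \<or> snd p \<inter> snd q = {}"
        using disjointD[OF partition_onD2[OF D], of "fst p" "fst q"]
          disjointD[OF partition_onD2[OF E], of "snd p" "snd q"]
        by (auto simp: mem_Times_iff prod_eq_iff)
      then show "fst p \<times> snd p \<inter> fst q \<times> snd q = {}"
        by blast
    qed
  qed
  moreover have "(\<Union>p\<in>D \<times> E. fst p \<times> snd p) = X \<times> Y"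
    unfolding partition_onD1[OF D] partition_onD1[OF E] by fastforce
  ultimately show ?thesis by simp
qed

section \<open>Noncrossing partitions of a linearly ordered set\<close>

text \<open>Refinement without reference to a ground set: it is reflexive on all families of sets,
  as the product construction requires.\<close>

definition below :: "'a set set \<Rightarrow> 'a set set \<Rightarrow> bool" where
  "below \<pi> \<mu> \<longleftrightarrow> (\<forall>B\<in>\<pi>. \<exists>C\<in>\<mu>. B \<subseteq> C)"

lemma below_refl: "below \<pi> \<pi>"
  unfolding below_def by blast

text \<open>Elements up to \<open>k\<close> stand for collinear points, hence an element of one block may not even lie
  between two of them that belong to another block.\<close>

definition cross :: "'a::linorder \<Rightarrow> 'a set \<Rightarrow> 'a set \<Rightarrow> bool" where
  "cross k B C \<longleftrightarrow> (\<exists>a\<in>B. \<exists>b\<in>C. \<exists>c\<in>B. a < b \<and> b < c \<and> (c \<le> k \<or> (\<exists>d\<in>C. c < d)))"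

definition ncs :: "'a::linorder \<Rightarrow> 'a set \<Rightarrow> 'a set set set" where
  "ncs k S = {\<pi>. partition_on S \<pi> \<and> (\<forall>B\<in>\<pi>. \<forall>C\<in>\<pi>. B \<noteq> C \<longrightarrow> \<not> cross k B C)}"

text \<open>Undoes the deletion of \<open>a\<close> from a partition in which \<open>a\<close>
  shares its block with \<open>j\<close>.\<close>

definition join :: "'a \<Rightarrow> 'a \<Rightarrow> 'a set set \<Rightarrow> 'a set set" where
  "join a j \<pi> = (\<lambda>B. if j \<in> B then insert a B else B) ` \<pi>"

definition next_in_block :: "'a::linorder \<Rightarrow> 'a \<Rightarrow> 'a set set \<Rightarrow> bool" where
  "next_in_block a j \<pi> \<longleftrightarrow> (\<exists>B\<in>\<pi>. a \<in> B \<and> j \<in> B \<and> (\<forall>x\<in>B. \<not> (a < x \<and> x < j)))"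

lemma partition_on_same_block:
  assumes "partition_on A P" "B \<in> P" "C \<in> P" "x \<in> B" "x \<in> C"
  shows "B = C"
  using assms unfolding partition_on_def disjoint_def by blast

lemma partition_on_obtain_block:
  assumes "partition_on A P" "x \<in> A"
  obtains B where "B \<in> P" "x \<in> B"
  using assms unfolding partition_on_def by blast

lemma cross_mono: "cross k B C \<Longrightarrow> B \<subseteq> B' \<Longrightarrow> C \<subseteq> C' \<Longrightarrow> cross k B' C'"
  unfolding cross_def by (meson subsetD)

lemma crossI1: "a \<in> B \<Longrightarrow> b \<in> C \<Longrightarrow> c \<in> B \<Longrightarrow> a < b \<Longrightarrow> b < c \<Longrightarrow> c \<le> k \<Longrightarrow> cross k B C"
  unfolding cross_def by blast

lemma crossI2: "a \<in> B \<Longrightarrow> b \<in> C \<Longrightarrow> c \<in> B \<Longrightarrow> d \<in> C \<Longrightarrow> a < b \<Longrightarrow> b < c \<Longrightarrow> c < d \<Longrightarrow> cross k B C"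
  unfolding cross_def by blast

lemma ncs_partition: "\<pi> \<in> ncs k S \<Longrightarrow> partition_on S \<pi>"
  unfolding ncs_def by blast

lemma ncs_not_cross: "\<pi> \<in> ncs k S \<Longrightarrow> B \<in> \<pi> \<Longrightarrow> C \<in> \<pi> \<Longrightarrow> B \<noteq> C \<Longrightarrow> \<not> cross k B C"
  unfolding ncs_def by blast

lemma ncs_finite: "finite S \<Longrightarrow> \<pi> \<in> ncs k S \<Longrightarrow> finite \<pi>"
  using finite_elements ncs_partition by blast

lemma ncs_block_subset: "\<pi> \<in> ncs k S \<Longrightarrow> B \<in> \<pi> \<Longrightarrow> B \<subseteq> S"
  using partition_onD1[OF ncs_partition] by blast

lemma ncs_block_nonempty: "\<pi> \<in> ncs k S \<Longrightarrow> B \<in> \<pi> \<Longrightarrow> B \<noteq> {}"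
  using partition_onD3[OF ncs_partition] by blast

lemma ncs_empty: "ncs k {} = {{}}"
  unfolding ncs_def by (auto simp: partition_on_empty)

lemma joinE:
  assumes "B' \<in> join a j \<pi>"
  obtains B where "B \<in> \<pi>" "B' = (if j \<in> B then insert a B else B)"
  using assms unfolding join_def by (rule imageE)

lemma inj_on_join:
  assumes "\<And>B. B \<in> \<pi> \<Longrightarrow> a \<notin> B"
  shows "inj_on (\<lambda>B. if j \<in> B then insert a B else B) \<pi>"
  using assms unfolding inj_on_def by (metis insert_ident insertI1)

text \<open>The new point \<open>a\<close> is smaller than all others, so in a crossing it can only
  be the leftmost point. There \<open>j\<close>, the minimum of \<open>Y\<close>, can replace it,
  which would give a crossing already present in \<pi>.\<close>

lemma join_ncs:
  assumes \<pi>: "\<pi> \<in> ncs k Y" and j: "j \<in> Y" "\<And>y. y \<in> Y \<Longrightarrow> j \<le> y" and a: "a < j"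
  shows "join a j \<pi> \<in> ncs k (insert a Y)"
proof -
  let ?f = "\<lambda>B. if j \<in> B then insert a B else B"
  have p: "partition_on Y \<pi>"
    using \<pi> by (rule ncs_partition)
  have aY: "a < y" if "y \<in> Y" for y
    using a j(2)[OF that] by simp
  have sub: "B \<subseteq> Y" if "B \<in> \<pi>" for B
    using ncs_block_subset[OF \<pi> that] .
  obtain J where J: "J \<in> \<pi>" "j \<in> J"
    using partition_on_obtain_block[OF p j(1)] .
  have U: "B = J" if "B \<in> \<pi>" "j \<in> B" for B
    using partition_on_same_block[OF p that(1) J(1) that(2) J(2)] .
  have "partition_on (insert a Y) (join a j \<pi>)"
  proof (rule partition_onI)
    show "\<Union> (join a j \<pi>) = insert a Y"
      using partition_onD1[OF p] J by (auto simp: join_def split: if_splits)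
    show "{} \<notin> join a j \<pi>"
      using partition_onD3[OF p] by (auto simp: join_def split: if_splits)
    fix B' C' assume BC': "B' \<in> join a j \<pi>" "C' \<in> join a j \<pi>" "B' \<noteq> C'"
    obtain B C where BC: "B \<in> \<pi>" "C \<in> \<pi>" "B' = ?f B" "C' = ?f C"
      using BC'(1,2) by (elim joinE)
    then have "B \<noteq> C"
      using BC'(3) by blast
    note BC = BC this
    have "B \<inter> C = {}"
      using partition_on_same_block[OF p BC(1,2)] BC(5) by blast
    moreover have "a \<notin> B" "a \<notin> C"
      using sub[OF BC(1)] sub[OF BC(2)] aY by blast+
    moreover have "\<not> (j \<in> B \<and> j \<in> C)"
      using U BC by blast
    ultimately show "disjnt B' C'"
      unfolding BC(3,4) disjnt_def by auto
  qed
  moreover have "\<not> cross k B' C'" if BC': "B' \<in> join a j \<pi>" "C' \<in> join a j \<pi>" "B' \<noteq> C'" for B' C'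
  proof
    assume "cross k B' C'"
    then obtain p q s where pqs: "p \<in> B'" "q \<in> C'" "s \<in> B'" "p < q" "q < s" "s \<le> k \<or> (\<exists>d\<in>C'. s < d)"
      unfolding cross_def by blast
    obtain B C where BC: "B \<in> \<pi>" "C \<in> \<pi>" "B' = ?f B" "C' = ?f C"
      using BC'(1,2) by (elim joinE)
    then have "B \<noteq> C"
      using BC'(3) by blast
    note BC = BC this
    have "B' \<subseteq> insert a Y"
      using BC(3) sub[OF BC(1)] by auto
    then have ge: "a \<le> x" if "x \<in> B'" for x
      using that aY by (metis insertE less_imp_le order_refl subsetD)
    have B: "x \<in> B" if "x \<in> B'" "a < x" for x
      using that BC(3) by (auto split: if_splits)
    have C: "x \<in> C" if "x \<in> C'" "a < x" for x
      using that BC(4) by (auto split: if_splits)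
    have "a \<le> p"
      using ge pqs(1) by blast
    then have q: "q \<in> C" and s: "s \<in> B" and aq: "a < q" "a < s"
      using B C pqs by auto
    have d: "s \<le> k \<or> (\<exists>d\<in>C. s < d)"
      using pqs(6) C aq by (meson less_trans)
    have "\<exists>p'\<in>B. p' < q"
    proof (cases "a < p")
      case True
      then show ?thesis
        using B pqs by blast
    next
      case False
      then have "a \<in> B'"
        using \<open>a \<le> p\<close> pqs(1) by simp
      then have "j \<in> B"
        using BC(1,3) sub[OF BC(1)] aY by (auto split: if_splits)
      moreover have "j \<noteq> q"
        using partition_on_same_block[OF p BC(1,2)] \<open>j \<in> B\<close> q BC(5) by blast
      moreover have "j \<le> q"
        using j(2) sub[OF BC(2)] q by blast
      ultimately show ?thesis
        by force
    qed
    then have "cross k B C"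
      unfolding cross_def using q s d pqs(5) by blast
    then show False
      using ncs_not_cross[OF \<pi> BC(1,2,5)] by blast
  qed
  ultimately show ?thesis
    unfolding ncs_def by blast
qed

text \<open>\<open>X\<close> lies in the gap between \<open>a\<close> and \<open>j\<close>, which
  \<open>Z\<close> avoids. A crossing of the two parts would have to go from \<open>a\<close> into
  \<open>X\<close> and back to some \<open>s\<close> with \<open>j \<le> s\<close>. To complete it,
  either \<open>s \<le> k\<close>, which \<open>k < j\<close> forbids, or a later element of
  \<open>X\<close> is required, and there is none.\<close>

lemma union_ncs:
  assumes \<pi>: "\<pi> \<in> ncs k X" and \<mu>: "\<mu> \<in> ncs k Z"
    and X: "\<And>x. x \<in> X \<Longrightarrow> a < x \<and> x < j" and Z: "\<And>z. z \<in> Z \<Longrightarrow> z = a \<or> j \<le> z"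
    and k: "X = {} \<or> k < j"
  shows "\<pi> \<union> \<mu> \<in> ncs k (X \<union> Z)"
proof -
  have XZ: "X \<inter> Z = {}"
    using X Z by fastforce
  have p: "partition_on X \<pi>" "partition_on Z \<mu>"
    using \<pi> \<mu> by (auto intro: ncs_partition)
  have "partition_on (X \<union> Z) (\<pi> \<union> \<mu>)"
    using p XZ unfolding partition_on_def by (auto intro: disjoint_union)
  moreover have "\<not> cross k B C" if BC: "B \<in> \<pi> \<union> \<mu>" "C \<in> \<pi> \<union> \<mu>" "B \<noteq> C" for B C
  proof
    assume c: "cross k B C"
    then obtain p q s where pqs: "p \<in> B" "q \<in> C" "s \<in> B" "p < q" "q < s" "s \<le> k \<or> (\<exists>d\<in>C. s < d)"
      unfolding cross_def by blast
    consider "B \<in> \<pi>" "C \<in> \<pi>" | "B \<in> \<mu>" "C \<in> \<mu>" | "B \<subseteq> X" "C \<subseteq> Z" | "B \<subseteq> Z" "C \<subseteq> X"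
      using BC ncs_block_subset[OF \<pi>] ncs_block_subset[OF \<mu>] by blast
    then show False
    proof cases
      case 1
      then show False
        using ncs_not_cross[OF \<pi>] BC(3) c by blast
    next
      case 2
      then show False
        using ncs_not_cross[OF \<mu>] BC(3) c by blast
    next
      case 3
      then show False
        using X[OF subsetD[OF 3(1) pqs(1)]] X[OF subsetD[OF 3(1) pqs(3)]] Z[OF subsetD[OF 3(2) pqs(2)]] pqs(4,5)
        by auto
    next
      case 4
      then have s: "j \<le> s"
        using X[OF subsetD[OF 4(2) pqs(2)]] Z[OF subsetD[OF 4(1) pqs(3)]] pqs(5) by auto
      have "k < j"
        using k 4 pqs(2) by blast
      then have "\<not> s \<le> k"
        using s by auto
      then obtain d where "d \<in> X" "s < d"
        using pqs(6) 4(2) by blast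
      then show False
        using X[of d] s by auto
    qed
  qed
  ultimately show ?thesis
    unfolding ncs_def by blast
qed

text \<open>The inverse collects the blocks inside \<open>X\<close> and deletes \<open>a\<close>
  from the others. It is well defined because the block containing \<open>a\<close> and
  \<open>j\<close> shields the gap between them: no block has points both in \<open>X\<close> and
  outside.\<close>

lemma bij_betw_union_join:
  assumes X: "\<And>x. x \<in> X \<Longrightarrow> a < x \<and> x < j" and Y: "j \<in> Y" "\<And>y. y \<in> Y \<Longrightarrow> j \<le> y"
    and a: "a < j" and k: "X = {} \<or> k < j"
  shows "bij_betw (\<lambda>p. fst p \<union> join a j (snd p)) (ncs k X \<times> ncs k Y)
           {\<pi> \<in> ncs k (insert a (X \<union> Y)). next_in_block a j \<pi>}"
proof (rule bij_betw_byWitness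
    [where f' = "\<lambda>\<pi>. ({B \<in> \<pi>. B \<subseteq> X}, (\<lambda>B. B - {a}) ` {B \<in> \<pi>. \<not> B \<subseteq> X})"])
  have XY: "X \<inter> Y = {}" and aX: "a \<notin> X" and aY: "a \<notin> Y"
    using X Y a by fastforce+
  have F: "\<pi> \<union> join a j \<mu> \<in> {\<pi> \<in> ncs k (insert a (X \<union> Y)). next_in_block a j \<pi>}"
    if \<pi>: "\<pi> \<in> ncs k X" and \<mu>: "\<mu> \<in> ncs k Y" for \<pi> \<mu>
  proof -
    have "\<pi> \<union> join a j \<mu> \<in> ncs k (X \<union> insert a Y)"
      using \<pi> join_ncs[OF \<mu> Y a] X _ k by (rule union_ncs) (use Y in auto)
    moreover obtain J where J: "J \<in> \<mu>" "j \<in> J"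
      using partition_on_obtain_block[OF ncs_partition[OF \<mu>] Y(1)] .
    then have "insert a J \<in> join a j \<mu>" "\<forall>x\<in>insert a J. \<not> (a < x \<and> x < j)"
      using ncs_block_subset[OF \<mu>] Y(2) by (auto simp: join_def image_iff dest!: subsetD intro!: bexI[of _ J]) fastforce
    then have "next_in_block a j (\<pi> \<union> join a j \<mu>)"
      using J unfolding next_in_block_def by blast
    ultimately show ?thesis
      by simp
  qed
  then show "(\<lambda>p. fst p \<union> join a j (snd p)) ` (ncs k X \<times> ncs k Y)
      \<subseteq> {\<pi> \<in> ncs k (insert a (X \<union> Y)). next_in_block a j \<pi>}"
    by auto
  show "\<forall>p\<in>ncs k X \<times> ncs k Y. ({B \<in> fst p \<union> join a j (snd p). B \<subseteq> X},
      (\<lambda>B. B - {a}) ` {B \<in> fst p \<union> join a j (snd p). \<not> B \<subseteq> X}) = p"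
  proof
    fix p assume "p \<in> ncs k X \<times> ncs k Y"
    then obtain \<pi> \<mu> where p: "p = (\<pi>, \<mu>)" "\<pi> \<in> ncs k X" "\<mu> \<in> ncs k Y"
      by auto
    have 1: "B \<subseteq> X" if "B \<in> \<pi>" for B
      using ncs_block_subset[OF p(2) that] .
    have B: "B \<subseteq> Y" "B \<noteq> {}" if "B \<in> \<mu>" for B
      using ncs_block_subset[OF p(3) that] ncs_block_nonempty[OF p(3) that] .
    have 2: "\<not> B \<subseteq> X" if "B \<in> join a j \<mu>" for B
      using that B XY aX unfolding join_def by (auto split: if_splits) blast
    have "{B \<in> \<pi> \<union> join a j \<mu>. B \<subseteq> X} = \<pi>"
      by (rule set_eqI) (use 1 2 in auto)
    moreover have "{B \<in> \<pi> \<union> join a j \<mu>. \<not> B \<subseteq> X} = join a j \<mu>"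
      by (rule set_eqI) (use 1 2 in auto)
    moreover have "(\<lambda>B. B - {a}) ` join a j \<mu> = (\<lambda>B. B) ` \<mu>"
      unfolding join_def image_image using B(1) aY by (intro image_cong) auto
    ultimately show "({B \<in> fst p \<union> join a j (snd p). B \<subseteq> X},
      (\<lambda>B. B - {a}) ` {B \<in> fst p \<union> join a j (snd p). \<not> B \<subseteq> X}) = p"
      using p by simp
  qed
  have G: "{B \<in> \<pi>. B \<subseteq> X} \<in> ncs k X \<and> (\<lambda>B. B - {a}) ` {B \<in> \<pi>. \<not> B \<subseteq> X} \<in> ncs k Y \<and>
      {B \<in> \<pi>. B \<subseteq> X} \<union> join a j ((\<lambda>B. B - {a}) ` {B \<in> \<pi>. \<not> B \<subseteq> X}) = \<pi>"
    if R: "\<pi> \<in> {\<pi> \<in> ncs k (insert a (X \<union> Y)). next_in_block a j \<pi>}" for \<pi>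
  proof -
    have \<pi>: "\<pi> \<in> ncs k (insert a (X \<union> Y))"
      using R by simp
    obtain J where J: "J \<in> \<pi>" "a \<in> J" "j \<in> J" "\<And>x. x \<in> J \<Longrightarrow> \<not> (a < x \<and> x < j)"
      using R unfolding next_in_block_def by auto
    note p = ncs_partition[OF \<pi>]
    have U: "B = C" if "B \<in> \<pi>" "C \<in> \<pi>" "x \<in> B" "x \<in> C" for B C x
      using partition_on_same_block[OF p that] .
    have sub: "B \<subseteq> insert a (X \<union> Y)" "B \<noteq> {}" if "B \<in> \<pi>" for B
      using ncs_block_subset[OF \<pi> that] ncs_block_nonempty[OF \<pi> that] .
    \<comment> \<open>Suppose \<open>B\<close> has a point \<open>x\<close> in \<open>X\<close> and
      a point \<open>y\<close> outside. As \<open>B\<close> differs from the block \<open>J\<close>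
      of \<open>a\<close> and \<open>j\<close>, it follows that \<open>j < y\<close>, and
      \<open>a < x < j < y\<close> alternates between \<open>J\<close> and \<open>B\<close>.\<close>
    have cases: "B \<inter> X = {}" if B: "B \<in> \<pi>" "\<not> B \<subseteq> X" for B
    proof (rule ccontr)
      assume "B \<inter> X \<noteq> {}"
      then obtain x y where xy: "x \<in> B" "x \<in> X" "y \<in> B" "y \<notin> X"
        using B by blast
      have "B \<noteq> J"
        using J(4) X xy by blast
      then have "y \<noteq> a" "y \<noteq> j"
        using U J B xy by blast+
      then have "j < y"
        using xy sub[OF B(1)] Y(2) by (metis UnE insertE le_neq_trans subsetD)
      then have "cross k J B"
        using crossI2[OF J(2) xy(1) J(3) xy(3)] X[OF xy(2)] by simp
      then show False
        using ncs_not_cross[OF \<pi> J(1) B(1)] \<open>B \<noteq> J\<close> by blast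
    qed
    have UN: "\<Union>\<pi> = insert a (X \<union> Y)"
      using partition_onD1[OF p] by simp
    have "partition_on X {B \<in> \<pi>. B \<subseteq> X}"
    proof (rule partition_onI)
      show "\<Union> {B \<in> \<pi>. B \<subseteq> X} = X"
        using cases UN by blast
      show "{} \<notin> {B \<in> \<pi>. B \<subseteq> X}"
        using sub by blast
      show "disjnt B C" if "B \<in> {B \<in> \<pi>. B \<subseteq> X}" "C \<in> {B \<in> \<pi>. B \<subseteq> X}" "B \<noteq> C" for B C
        using U that unfolding disjnt_def by blast
    qed
    then have 1: "{B \<in> \<pi>. B \<subseteq> X} \<in> ncs k X"
      unfolding ncs_def using ncs_not_cross[OF \<pi>] by simp
    have "partition_on Y ((\<lambda>B. B - {a}) ` {B \<in> \<pi>. \<not> B \<subseteq> X})"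
    proof (rule partition_onI)
      have "\<Union> {B \<in> \<pi>. \<not> B \<subseteq> X} = insert a Y"
      proof
        show "\<Union> {B \<in> \<pi>. \<not> B \<subseteq> X} \<subseteq> insert a Y"
        proof
          fix y assume "y \<in> \<Union> {B \<in> \<pi>. \<not> B \<subseteq> X}"
          then obtain B where "B \<in> \<pi>" "\<not> B \<subseteq> X" "y \<in> B"
            by blast
          then show "y \<in> insert a Y"
            using cases[of B] sub(1)[of B] by blast
        qed
        show "insert a Y \<subseteq> \<Union> {B \<in> \<pi>. \<not> B \<subseteq> X}"
        proof
          fix y assume "y \<in> insert a Y"
          then have "y \<in> \<Union> \<pi>" "y \<notin> X"
            using UN XY aX by auto
          then show "y \<in> \<Union> {B \<in> \<pi>. \<not> B \<subseteq> X}"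
            by blast
        qed
      qed
      then show "\<Union> ((\<lambda>B. B - {a}) ` {B \<in> \<pi>. \<not> B \<subseteq> X}) = Y"
        using aY by auto
      \<comment> \<open>The block of \<open>a\<close> also contains \<open>j\<close>, so deleting
        \<open>a\<close> does not empty it.\<close>
      show "{} \<notin> (\<lambda>B. B - {a}) ` {B \<in> \<pi>. \<not> B \<subseteq> X}"
      proof
        assume "{} \<in> (\<lambda>B. B - {a}) ` {B \<in> \<pi>. \<not> B \<subseteq> X}"
        then obtain B where B: "B \<in> \<pi>" "B \<subseteq> {a}"
          by blast
        then have "a \<in> B"
          using sub(2) by blast
        then have "j \<in> B"
          using U[OF B(1) J(1) _ J(2)] J(3) by blast
        then show False
          using B a by auto
      qed
      show "disjnt B' C'" if "B' \<in> (\<lambda>B. B - {a}) ` {B \<in> \<pi>. \<not> B \<subseteq> X}"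
        "C' \<in> (\<lambda>B. B - {a}) ` {B \<in> \<pi>. \<not> B \<subseteq> X}" "B' \<noteq> C'" for B' C'
        using U that unfolding disjnt_def by blast
    qed
    moreover have "\<not> cross k (B - {a}) (C - {a})" if "B \<in> \<pi>" "C \<in> \<pi>" "B - {a} \<noteq> C - {a}" for B C
      using ncs_not_cross[OF \<pi> that(1,2)] that(3) cross_mono[of k "B - {a}" "C - {a}" B C] by blast
    ultimately have 2: "(\<lambda>B. B - {a}) ` {B \<in> \<pi>. \<not> B \<subseteq> X} \<in> ncs k Y"
      unfolding ncs_def by blast
    have "(if j \<in> B - {a} then insert a (B - {a}) else B - {a}) = B" if "B \<in> \<pi>" for B
    proof (cases "a \<in> B")
      case True
      then have "j \<in> B"
        using U[OF that J(1) True J(2)] J(3) by blast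
      then show ?thesis
        using True a by auto
    next
      case False
      then have "j \<notin> B"
        using U[OF that J(1) _ J(3)] J(2) by blast
      then show ?thesis
        using False by auto
    qed
    then have "join a j ((\<lambda>B. B - {a}) ` {B \<in> \<pi>. \<not> B \<subseteq> X}) = (\<lambda>B. B) ` {B \<in> \<pi>. \<not> B \<subseteq> X}"
      unfolding join_def image_image by (intro image_cong) auto
    then show ?thesis
      using 1 2 by blast
  qed
  show "\<forall>\<pi>\<in>{\<pi> \<in> ncs k (insert a (X \<union> Y)). next_in_block a j \<pi>}.
      fst ({B \<in> \<pi>. B \<subseteq> X}, (\<lambda>B. B - {a}) ` {B \<in> \<pi>. \<not> B \<subseteq> X}) \<union>
      join a j (snd ({B \<in> \<pi>. B \<subseteq> X}, (\<lambda>B. B - {a}) ` {B \<in> \<pi>. \<not> B \<subseteq> X})) = \<pi>"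
    using G by simp
  show "(\<lambda>\<pi>. ({B \<in> \<pi>. B \<subseteq> X}, (\<lambda>B. B - {a}) ` {B \<in> \<pi>. \<not> B \<subseteq> X})) `
      {\<pi> \<in> ncs k (insert a (X \<union> Y)). next_in_block a j \<pi>} \<subseteq> ncs k X \<times> ncs k Y"
    using G by auto
qed

lemma bij_betw_insert_singleton:
  assumes a: "\<And>y. y \<in> Y \<Longrightarrow> a < y"
  shows "bij_betw (insert {a}) (ncs k Y) {\<pi> \<in> ncs k (insert a Y). {a} \<in> \<pi>}"
proof (rule bij_betw_byWitness[where f' = "\<lambda>\<pi>. \<pi> - {{a}}"])
  have aY: "a \<notin> Y"
    using a by blast
  show "\<forall>\<pi>\<in>ncs k Y. insert {a} \<pi> - {{a}} = \<pi>"
    using ncs_block_subset aY by fastforce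
  show "\<forall>\<pi>\<in>{\<pi> \<in> ncs k (insert a Y). {a} \<in> \<pi>}. insert {a} (\<pi> - {{a}}) = \<pi>"
    by blast
  have ins: "partition_on (insert a Y) (insert {a} \<pi>)" if "partition_on Y \<pi>" for \<pi>
    using that aY unfolding partition_on_def by (auto simp: disjoint_def)
  have "insert {a} \<pi> \<in> ncs k (insert a Y)" if \<pi>: "\<pi> \<in> ncs k Y" for \<pi>
  proof -
    have "\<not> cross k {a} C" for C
      unfolding cross_def by auto
    moreover have "\<not> cross k B {a}" if "B \<in> \<pi>" for B
      using ncs_block_subset[OF \<pi> that] a unfolding cross_def by fastforce
    ultimately show ?thesis
      using ins[OF ncs_partition[OF \<pi>]] ncs_not_cross[OF \<pi>] unfolding ncs_def by auto
  qed
  then show "insert {a} ` ncs k Y \<subseteq> {\<pi> \<in> ncs k (insert a Y). {a} \<in> \<pi>}"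
    by blast
  have "\<pi> - {{a}} \<in> ncs k Y" if \<pi>: "\<pi> \<in> ncs k (insert a Y)" "{a} \<in> \<pi>" for \<pi>
  proof -
    have "insert {a} (\<pi> - {{a}}) = \<pi>"
      using \<pi> by blast
    moreover have "disjnt {a} (\<Union> (\<pi> - {{a}}))"
      using partition_on_same_block[OF ncs_partition[OF \<pi>(1)] \<pi>(2)] by auto
    ultimately have "partition_on Y (\<pi> - {{a}})"
      using partition_on_insert[of "{a}" "\<pi> - {{a}}" "insert a Y"] ncs_partition[OF \<pi>(1)] aY by simp
    then show ?thesis
      using ncs_not_cross[OF \<pi>(1)] unfolding ncs_def by blast
  qed
  then show "(\<lambda>\<pi>. \<pi> - {{a}}) ` {\<pi> \<in> ncs k (insert a Y). {a} \<in> \<pi>} \<subseteq> ncs k Y"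
    by blast
qed

lemma card_join:
  assumes "\<And>B. B \<in> \<pi> \<Longrightarrow> a \<notin> B"
  shows "card (join a j \<pi>) = card \<pi>"
  unfolding join_def using inj_on_join[OF assms] by (rule card_image)

lemma below_union_join:
  assumes "below \<pi> \<pi>'" "below \<mu> \<mu>'"
  shows "below (\<pi> \<union> join a j \<mu>) (\<pi>' \<union> join a j \<mu>')"
  unfolding below_def
proof
  fix B assume "B \<in> \<pi> \<union> join a j \<mu>"
  then consider "B \<in> \<pi>" | C where "C \<in> \<mu>" "B = (if j \<in> C then insert a C else C)"
    by (auto elim: joinE)
  then show "\<exists>C\<in>\<pi>' \<union> join a j \<mu>'. B \<subseteq> C"
  proof cases
    case 1
    then show ?thesis
      using assms(1) unfolding below_def by blast
  next
    case 2
    then obtain D where D: "D \<in> \<mu>'" "C \<subseteq> D"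
      using assms(2) unfolding below_def by blast
    then have "(if j \<in> D then insert a D else D) \<in> join a j \<mu>'"
      unfolding join_def by blast
    moreover have "B \<subseteq> (if j \<in> D then insert a D else D)"
      using 2(2) D(2) by auto
    ultimately show ?thesis
      by blast
  qed
qed

text \<open>Joining \<open>a\<close> to an existing block leaves the number of blocks alone, so
  ranks add with offset 0 and the centre is the sum of the two centres.\<close>

lemma scd_next_in_block:
  fixes X Y :: "'a::linorder set"
  assumes fin: "finite X" "finite Y"
    and IH: "scd (ncs k X) below (\<lambda>\<pi>. - int (card \<pi>)) N" "scd (ncs k Y) below (\<lambda>\<pi>. - int (card \<pi>)) M"
    and X: "\<And>x. x \<in> X \<Longrightarrow> a < x \<and> x < j" and Y: "j \<in> Y" "\<And>y. y \<in> Y \<Longrightarrow> j \<le> y"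
    and a: "a < j" and k: "X = {} \<or> k < j"
  shows "scd {\<pi> \<in> ncs k (insert a (X \<union> Y)). next_in_block a j \<pi>} below (\<lambda>\<pi>. - int (card \<pi>)) (N + M)"
proof -
  let ?f = "\<lambda>p. fst p \<union> join a j (snd p)"
  have prod: "scd (ncs k X \<times> ncs k Y) (\<lambda>p q. below (fst p) (fst q) \<and> below (snd p) (snd q))
      (\<lambda>p. - int (card (fst p)) + - int (card (snd p))) (N + M)"
    using IH below_refl below_refl by (rule scd_prod)
  have bij: "bij_betw ?f (ncs k X \<times> ncs k Y) {\<pi> \<in> ncs k (insert a (X \<union> Y)). next_in_block a j \<pi>}"
    using X Y a k by (rule bij_betw_union_join)
  have "scd {\<pi> \<in> ncs k (insert a (X \<union> Y)). next_in_block a j \<pi>} below (\<lambda>\<pi>. - int (card \<pi>)) (N + M + 2 * 0)"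
  proof (rule scd_image[where f = ?f, OF prod bij])
    fix p q :: "'a set set \<times> 'a set set"
    assume "below (fst p) (fst q) \<and> below (snd p) (snd q)"
    then show "below (?f p) (?f q)"
      by (intro below_union_join) auto
  next
    fix p assume p: "p \<in> ncs k X \<times> ncs k Y"
    then have p1: "fst p \<in> ncs k X" and p2: "snd p \<in> ncs k Y"
      by auto
    have aY: "a \<notin> Y"
      using Y(2)[of a] a by auto
    have XY: "X \<inter> Y = {}"
      using X Y(2) by (meson disjoint_iff not_le)
    have "B \<notin> join a j (snd p)" if B: "B \<in> fst p" for B
    proof
      assume "B \<in> join a j (snd p)"
      then obtain C where C: "C \<in> snd p" "C \<subseteq> B"
        by (rule joinE) (metis order_refl subset_insertI)
      then show False
        using ncs_block_subset[OF p1 B] ncs_block_subset[OF p2 C(1)] ncs_block_nonempty[OF p2 C(1)] XY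
        by blast
    qed
    then have "card (fst p \<union> join a j (snd p)) = card (fst p) + card (join a j (snd p))"
      using ncs_finite[OF fin(1) p1] ncs_finite[OF fin(2) p2]
      by (intro card_Un_disjoint) (auto simp: join_def)
    also have "card (join a j (snd p)) = card (snd p)"
      using ncs_block_subset[OF p2] aY by (intro card_join) blast
    finally show "- int (card (fst p \<union> join a j (snd p))) = - int (card (fst p)) + - int (card (snd p)) + 0"
      by simp
  qed
  then show ?thesis
    by simp
qed

text \<open>Both kinds of partitions are copies of \<open>ncs k Y\<close>, with centres
  \<open>N - 2\<close> for \<open>{a}\<close> alone and \<open>N\<close> for \<open>a\<close> joined
  to \<open>b\<close>. The bit in the product records which copy is meant: \<open>False\<close> for
  the singleton, \<open>True\<close> for the join.\<close>

lemma scd_min_singleton_or_joined: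
  fixes Y :: "'a::linorder set"
  assumes fin: "finite Y" and IH: "scd (ncs k Y) below (\<lambda>\<pi>. - int (card \<pi>)) N"
    and b: "b \<in> Y" "\<And>y. y \<in> Y \<Longrightarrow> b \<le> y" and a: "a < b"
  shows "scd {\<pi> \<in> ncs k (insert a Y). {a} \<in> \<pi> \<or> next_in_block a b \<pi>} below (\<lambda>\<pi>. - int (card \<pi>)) (N - 1)"
proof -
  let ?f = "\<lambda>p. if fst p then join a b (snd p) else insert {a} (snd p)"
  have aY: "a < y" if "y \<in> Y" for y
    using a b(2)[OF that] by simp
  \<comment> \<open>The two-element chain has ranks 0 and 1, hence centre 1; the rank offset -1 in
    the final image turns \<open>1 + N\<close> into \<open>N - 1\<close>.\<close>
  have bools: "scd UNIV (\<le>) (\<lambda>c. if c then 1 else 0) 1"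
    using scd_chain[of "[False, True]" "(\<le>)" "\<lambda>c. if c then 1 else 0" 1] by (simp add: UNIV_bool)
  have "bij_betw (\<lambda>p. join a b (snd p)) ({True} \<times> ncs k Y) {\<pi> \<in> ncs k (insert a Y). next_in_block a b \<pi>}"
  proof -
    \<comment> \<open>The successor bijection is used with an empty gap, whose only partition is the
      empty family; the bit is traded for that trivial factor.\<close>
    have "bij_betw (\<lambda>p. ({}, snd p)) ({True} \<times> ncs k Y) ({{}} \<times> ncs k Y)"
      by (rule bij_betw_byWitness[where f' = "\<lambda>p. (True, snd p)"]) auto
    moreover have "bij_betw (\<lambda>p. fst p \<union> join a b (snd p)) ({{}} \<times> ncs k Y)
        {\<pi> \<in> ncs k (insert a Y). next_in_block a b \<pi>}"
      using bij_betw_union_join[of "{}" a b Y k] b a by (simp add: ncs_empty)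
    ultimately show ?thesis
      by (rule bij_betw_trans[unfolded comp_def, THEN bij_betw_cong[THEN iffD1, rotated]]) simp
  qed
  then have T: "bij_betw ?f ({True} \<times> ncs k Y) {\<pi> \<in> ncs k (insert a Y). next_in_block a b \<pi>}"
    by (rule bij_betw_cong[THEN iffD1, rotated]) auto
  have "bij_betw (\<lambda>p. insert {a} (snd p)) ({False} \<times> ncs k Y) {\<pi> \<in> ncs k (insert a Y). {a} \<in> \<pi>}"
  proof -
    have "bij_betw snd ({False} \<times> ncs k Y) (ncs k Y)"
      by (rule bij_betw_byWitness[where f' = "\<lambda>\<pi>. (False, \<pi>)"]) auto
    then show ?thesis
      using bij_betw_trans[OF _ bij_betw_insert_singleton[OF aY]] by (fastforce simp: comp_def)
  qed
  then have F: "bij_betw ?f ({False} \<times> ncs k Y) {\<pi> \<in> ncs k (insert a Y). {a} \<in> \<pi>}"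
    by (rule bij_betw_cong[THEN iffD1, rotated]) auto
  have disj: "\<not> next_in_block a b \<pi>" if "\<pi> \<in> ncs k (insert a Y)" "{a} \<in> \<pi>" for \<pi>
  proof
    assume "next_in_block a b \<pi>"
    then obtain B where "B \<in> \<pi>" "a \<in> B" "b \<in> B"
      unfolding next_in_block_def by blast
    then have "B = {a}"
      using partition_on_same_block[OF ncs_partition[OF that(1)] _ that(2)] by blast
    then show False
      using \<open>b \<in> B\<close> a by simp
  qed
  have "bij_betw ?f ({True} \<times> ncs k Y \<union> {False} \<times> ncs k Y)
      ({\<pi> \<in> ncs k (insert a Y). next_in_block a b \<pi>} \<union> {\<pi> \<in> ncs k (insert a Y). {a} \<in> \<pi>})"
    using T F by (rule bij_betw_combine) (use disj in auto)
  moreover have "{True} \<times> ncs k Y \<union> {False} \<times> ncs k Y = UNIV \<times> ncs k Y"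
    by auto
  moreover have "{\<pi> \<in> ncs k (insert a Y). next_in_block a b \<pi>} \<union> {\<pi> \<in> ncs k (insert a Y). {a} \<in> \<pi>}
      = {\<pi> \<in> ncs k (insert a Y). {a} \<in> \<pi> \<or> next_in_block a b \<pi>}"
    by auto
  ultimately have bij: "bij_betw ?f (UNIV \<times> ncs k Y) {\<pi> \<in> ncs k (insert a Y). {a} \<in> \<pi> \<or> next_in_block a b \<pi>}"
    by simp
  have "scd {\<pi> \<in> ncs k (insert a Y). {a} \<in> \<pi> \<or> next_in_block a b \<pi>} below (\<lambda>\<pi>. - int (card \<pi>))
      (1 + N + 2 * - 1)"
  proof (rule scd_image[OF scd_prod[OF bools IH order_refl below_refl] bij])
    fix p q :: "bool \<times> 'a set set"
    assume pq: "p \<in> UNIV \<times> ncs k Y" "q \<in> UNIV \<times> ncs k Y" "fst p \<le> fst q \<and> below (snd p) (snd q)"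
    then have q: "snd q \<in> ncs k Y"
      by auto
    have J: "below (join a b (snd p)) (join a b (snd q))"
      using below_union_join[OF below_refl[of "{}"]] pq by fastforce
    have I: "below (insert {a} (snd p)) (insert {a} (snd q))"
      using pq unfolding below_def by auto
    \<comment> \<open>The step from bit \<open>False\<close> to bit \<open>True\<close>: the
      singleton \<open>{a}\<close> is absorbed by the block of \<open>b\<close>.\<close>
    have IJ: "below (insert {a} (snd p)) (join a b (snd q))"
      unfolding below_def
    proof
      fix B assume B: "B \<in> insert {a} (snd p)"
      obtain C where C: "C \<in> snd q" "B = {a} \<and> b \<in> C \<or> B \<subseteq> C"
      proof (cases "B = {a}")
        case True
        then show ?thesis
          using partition_on_obtain_block[OF ncs_partition[OF q] b(1)] that by blast
      next
        case False
        then show ?thesis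
          using B pq(3) that unfolding below_def by blast
      qed
      then show "\<exists>C\<in>join a b (snd q). B \<subseteq> C"
        unfolding join_def by (intro bexI[of _ "if b \<in> C then insert a C else C"]) auto
    qed
    show "below (?f p) (?f q)"
      using J I IJ pq(3) by auto
  next
    fix p :: "bool \<times> 'a set set" assume "p \<in> UNIV \<times> ncs k Y"
    then have p: "snd p \<in> ncs k Y"
      by auto
    have aB: "a \<notin> B" if "B \<in> snd p" for B
      using ncs_block_subset[OF p that] aY by blast
    have "card (insert {a} (snd p)) = Suc (card (snd p))"
      using aB by (intro card_insert_disjoint ncs_finite[OF fin p]) blast
    moreover have "card (join a b (snd p)) = card (snd p)"
      using aB by (rule card_join)
    ultimately show "- int (card (?f p)) = (if fst p then 1 else 0) + - int (card (snd p)) + - 1"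
      by auto
  qed
  then show ?thesis
    by simp
qed

section \<open>Induction on the successor of the smallest point\<close>

text \<open>The constant is the sum of the extreme ranks: -|S| for the partition into singletons and
  -1 for the single block. For the empty set the two coincide at 0, so the induction is confined to
  nonempty sets.\<close>

theorem scd_ncs:
  fixes S :: "'a::linorder set"
  assumes "finite S" "S \<noteq> {}"
  shows "scd (ncs k S) below (\<lambda>\<pi>. - int (card \<pi>)) (- int (card S) - 1)"
  using assms
proof (induction S rule: finite_psubset_induct)
  case (psubset S)
  define a where "a = Min S"
  define Y where "Y = S - {a}"
  have aS: "a \<in> S" and a: "\<And>y. y \<in> Y \<Longrightarrow> a < y"
    using psubset unfolding a_def Y_def by (auto simp: le_neq_trans[OF Min_le])
  have S: "S = insert a Y" and aY: "a \<notin> Y" and fY: "finite Y"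
    using aS psubset.hyps unfolding Y_def by auto
  show ?case
  proof (cases "Y = {}")
    case True
    have "ncs k {a} = {{{a}}}"
    proof -
      have "partition_on {a} \<pi> \<longleftrightarrow> \<pi> = {{a}}" for \<pi>
      proof
        assume "partition_on {a} \<pi>"
        then have U: "\<Union>\<pi> = {a}" and e: "{} \<notin> \<pi>"
          unfolding partition_on_def by auto
        have "B = {a}" if "B \<in> \<pi>" for B
          using that U e Union_upper[OF that] by (metis subset_singletonD)
        moreover have "\<pi> \<noteq> {}"
          using U by auto
        ultimately show "\<pi> = {{a}}"
          by blast
      qed (simp add: partition_on_space)
      then show ?thesis
        unfolding ncs_def by auto
    qed
    then show ?thesis
      using scd_chain[of "[{{a}}]" below "\<lambda>\<pi>. - int (card \<pi>)"] S True by simp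
  next
    case False
    define b where "b = Min Y"
    have b: "b \<in> Y" "\<And>y. y \<in> Y \<Longrightarrow> b \<le> y"
      using False fY unfolding b_def by auto
    define R where "R j = {\<pi> \<in> ncs k S. next_in_block a j \<pi>}" for j
    define R1 where "R1 = {\<pi> \<in> ncs k S. {a} \<in> \<pi> \<or> next_in_block a b \<pi>}"
    \<comment> \<open>Successors \<open>j\<close> with \<open>b < j \<le> k\<close> are left out:
      then \<open>b\<close> lies between \<open>a\<close> and \<open>j\<close> among the collinear
      points, and its block would be crossed by theirs.\<close>
    define J where "J = {j \<in> Y. b < j \<and> k < j}"
    have "scd R1 below (\<lambda>\<pi>. - int (card \<pi>)) ((- int (card Y) - 1) - 1)"
      unfolding R1_def S
    proof (rule scd_min_singleton_or_joined[OF fY _ b a[OF b(1)]])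
      show "scd (ncs k Y) below (\<lambda>\<pi>. - int (card \<pi>)) (- int (card Y) - 1)"
        using psubset.IH[of Y] S aY False by blast
    qed
    moreover have cS: "card S = Suc (card Y)"
      using S aY fY by simp
    ultimately have 1: "scd R1 below (\<lambda>\<pi>. - int (card \<pi>)) (- int (card S) - 1)"
      by simp
    have 2: "scd (R j) below (\<lambda>\<pi>. - int (card \<pi>)) (- int (card S) - 1)" if j: "j \<in> J" for j
    proof -
      define X where "X = {x \<in> Y. x < j}"
      define Z where "Z = {x \<in> Y. j \<le> x}"
      have jY: "j \<in> Y" "b < j" "k < j"
        using j unfolding J_def by auto
      have XZ: "Y = X \<union> Z" "X \<inter> Z = {}" "finite X" "finite Z"
        using fY unfolding X_def Z_def by auto
      have bX: "b \<in> X" and jZ: "j \<in> Z"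
        using jY b(1) unfolding X_def Z_def by auto
      \<comment> \<open>Both factors are nonempty, as \<open>b\<close> is in \<open>X\<close> and
        \<open>j\<close> in \<open>Z\<close>, so the induction hypothesis gives each the regular
        centre.\<close>
      have "scd {\<pi> \<in> ncs k (insert a (X \<union> Z)). next_in_block a j \<pi>} below (\<lambda>\<pi>. - int (card \<pi>))
          ((- int (card X) - 1) + (- int (card Z) - 1))"
      proof (rule scd_next_in_block[OF XZ(3,4)])
        show "scd (ncs k X) below (\<lambda>\<pi>. - int (card \<pi>)) (- int (card X) - 1)"
          using bX S aY XZ by (intro psubset.IH) auto
        show "scd (ncs k Z) below (\<lambda>\<pi>. - int (card \<pi>)) (- int (card Z) - 1)"
          using jZ S aY XZ by (intro psubset.IH) auto
        show "a < j" "j \<in> Z" "X = {} \<or> k < j"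
          using a jY jZ by auto
        show "a < x \<and> x < j" if "x \<in> X" for x
          using that a unfolding X_def by auto
        show "j \<le> x" if "x \<in> Z" for x
          using that unfolding Z_def by auto
      qed
      moreover have "card S = Suc (card X + card Z)"
        using cS XZ card_Un_disjoint[of X Z] by simp
      ultimately show ?thesis
        unfolding R_def using S XZ(1) by (simp add: algebra_simps)
    qed
    have next_unique: "i = j" if n: "\<pi> \<in> ncs k S" "next_in_block a i \<pi>" "next_in_block a j \<pi>" "a < i" "a < j" for i j \<pi>
    proof -
      obtain B where B: "B \<in> \<pi>" "a \<in> B" "i \<in> B" "\<forall>x\<in>B. \<not> (a < x \<and> x < i)"
        using n(2) unfolding next_in_block_def by blast
      obtain C where C: "C \<in> \<pi>" "a \<in> C" "j \<in> C" "\<forall>x\<in>C. \<not> (a < x \<and> x < j)"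
        using n(3) unfolding next_in_block_def by blast
      have "B = C"
        using partition_on_same_block[OF ncs_partition[OF n(1)] B(1) C(1) B(2) C(2)] .
      then show ?thesis
        using B C n(4,5) by (metis linorder_less_linear)
    qed
    have not_singleton: "{a} \<notin> \<pi>" if \<pi>: "\<pi> \<in> ncs k S" "next_in_block a j \<pi>" "a < j" for j \<pi>
    proof
      assume s: "{a} \<in> \<pi>"
      obtain B where B: "B \<in> \<pi>" "a \<in> B" "j \<in> B"
        using \<pi>(2) unfolding next_in_block_def by blast
      then have "B = {a}"
        using partition_on_same_block[OF ncs_partition[OF \<pi>(1)] B(1) s] by blast
      then show False
        using B \<pi>(3) by simp
    qed
    have J: "a < j \<and> j \<noteq> b" if "j \<in> J" for j
      using that a unfolding J_def by auto
    have 3: "scd (\<Union>j\<in>J. R j) below (\<lambda>\<pi>. - int (card \<pi>)) (- int (card S) - 1)"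
    proof (rule scd_UN[OF 2])
      show "disjoint_family_on R J"
        unfolding disjoint_family_on_def
      proof (intro ballI impI)
        fix i j assume ij: "i \<in> J" "j \<in> J" "i \<noteq> j"
        show "R i \<inter> R j = {}"
          using next_unique[of _ i j] J[OF ij(1)] J[OF ij(2)] ij(3) unfolding R_def by blast
      qed
    qed
    have 4: "R1 \<inter> (\<Union>j\<in>J. R j) = {}"
    proof (rule ccontr)
      assume "R1 \<inter> (\<Union>j\<in>J. R j) \<noteq> {}"
      then obtain \<pi> j where \<pi>: "\<pi> \<in> R1" "\<pi> \<in> R j" "j \<in> J"
        by blast
      then have "next_in_block a b \<pi>"
        using not_singleton[of \<pi> j] J[of j] unfolding R1_def R_def by blast
      then show False
        using next_unique[of \<pi> b j] \<pi> J[of j] a[OF b(1)] unfolding R_def by blast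
    qed
    have "\<pi> \<in> R1 \<union> (\<Union>j\<in>J. R j)" if \<pi>: "\<pi> \<in> ncs k S" for \<pi>
    proof -
      obtain B where B: "B \<in> \<pi>" "a \<in> B"
        using partition_on_obtain_block[OF ncs_partition[OF \<pi>] aS] .
      have BS: "B \<subseteq> S"
        using ncs_block_subset[OF \<pi> B(1)] .
      show ?thesis
      proof (cases "B = {a}")
        case True
        then show ?thesis
          using B \<pi> unfolding R1_def by simp
      next
        case ne: False
        define j where "j = Min (B - {a})"
        have fB: "finite (B - {a})"
          using finite_subset[OF BS psubset.hyps] by simp
        have "B - {a} \<noteq> {}"
          using ne B(2) by blast
        then have j: "j \<in> B - {a}" "\<And>x. x \<in> B - {a} \<Longrightarrow> j \<le> x"
          unfolding j_def using Min_in[OF fB] Min_le[OF fB] by blast+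
        then have n: "next_in_block a j \<pi>"
          unfolding next_in_block_def using B
          by (intro bexI[of _ B]) (use j leD in \<open>blast+\<close>)
        have jY: "j \<in> Y"
          using j(1) BS S by auto
        show ?thesis
        proof (cases "j = b")
          case True
          then show ?thesis
            using n \<pi> unfolding R1_def by simp
        next
          case jb: False
          then have "b < j"
            using b(2)[OF jY] by simp
          moreover have "k < j"
          proof (rule ccontr)
            assume "\<not> k < j"
            have "b \<notin> B"
              using j(2)[of b] leD[of j b] \<open>b < j\<close> a[OF b(1)] by blast
            moreover obtain C where C: "C \<in> \<pi>" "b \<in> C"
              using partition_on_obtain_block[OF ncs_partition[OF \<pi>]] b(1) S by blast
            moreover have "cross k B C"
              using crossI1[OF B(2) C(2) _ a[OF b(1)] \<open>b < j\<close>] j(1) \<open>\<not> k < j\<close> by simp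
            ultimately show False
              using ncs_not_cross[OF \<pi> B(1) C(1)] by blast
          qed
          ultimately have "j \<in> J"
            using jY unfolding J_def by simp
          then show ?thesis
            using n \<pi> unfolding R_def by blast
        qed
      qed
    qed
    then have "ncs k S = R1 \<union> (\<Union>j\<in>J. R j)"
      unfolding R1_def R_def by blast
    then show ?thesis
      using scd_Un[OF 1 3 4] by simp
  qed
qed

section \<open>Geometry of the half disk\<close>

definition half_disk_boundary :: "complex set" where
  "half_disk_boundary = closed_segment (-1) 1 \<union> {cis \<theta> | \<theta>. 0 < \<theta> \<and> \<theta> < pi}"

text \<open>Counterclockwise position along the boundary of the half disk: the diameter is sent to
  \<open>[-1, 1]\<close> and the open arc to \<open>(1, 3)\<close>.\<close>

definition key :: "complex \<Rightarrow> real" where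
  "key z = (if Im z = 0 then Re z else 2 - Re z)"

text \<open>Twice the signed area of the triangle \<open>p\<close>, \<open>q\<close>,
  \<open>r\<close>, positive if they are in counterclockwise order.\<close>

definition orient :: "complex \<Rightarrow> complex \<Rightarrow> complex \<Rightarrow> real" where
  "orient p q r = (Re q - Re p) * (Im r - Im p) - (Im q - Im p) * (Re r - Re p)"

lemma half_disk_boundary_cases:
  assumes "z \<in> half_disk_boundary"
  obtains t where "z = of_real t" "-1 \<le> t" "t \<le> 1" "key z = t"
  | \<theta> where "z = cis \<theta>" "0 < \<theta>" "\<theta> < pi" "key z = 2 - cos \<theta>" "1 < key z"
proof (cases "z \<in> closed_segment (-1) 1")
  case True
  have "closed_segment (-1) 1 = closed_segment (of_real (-1)) (of_real 1 :: complex)"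
    by simp
  also have "\<dots> = of_real ` closed_segment (-1) 1"
    by (rule closed_segment_of_real)
  finally obtain t where t: "z = of_real t" "t \<in> closed_segment (-1) 1"
    using True by auto
  then have "-1 \<le> t" "t \<le> 1"
    by (auto simp: closed_segment_eq_real_ivl)
  then show ?thesis
    using t(1) that(1) by (simp add: key_def)
next
  case False
  then obtain \<theta> where \<theta>: "z = cis \<theta>" "0 < \<theta>" "\<theta> < pi"
    using assms unfolding half_disk_boundary_def by blast
  moreover have "cos \<theta> < 1"
    using \<theta> cos_monotone_0_pi[of 0 \<theta>] by simp
  ultimately show ?thesis
    using that(2)[of \<theta>] sin_gt_zero[of \<theta>] by (simp add: key_def)
qed

lemma key_le_1:
  assumes "z \<in> half_disk_boundary" "key z \<le> 1"
  shows "z = of_real (key z)"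
  using assms by (cases rule: half_disk_boundary_cases) auto

lemma key_gt_1:
  assumes "z \<in> half_disk_boundary" "1 < key z"
  obtains \<theta> where "z = cis \<theta>" "0 < \<theta>" "\<theta> < pi" "key z = 2 - cos \<theta>"
  using assms(1)
proof (cases rule: half_disk_boundary_cases)
  case 1
  then show ?thesis
    using assms(2) by simp
next
  case (2 \<theta>)
  then show ?thesis
    by (intro that)
qed

lemma inj_on_key: "inj_on key half_disk_boundary"
proof (rule inj_onI)
  fix z w assume z: "z \<in> half_disk_boundary" and w: "w \<in> half_disk_boundary" and eq: "key z = key w"
  show "z = w"
  proof (cases "key z \<le> 1")
    case True
    then show ?thesis
      using key_le_1[OF z] key_le_1[OF w] eq by simp
  next
    case False
    then have gt: "1 < key z" "1 < key w"
      using eq by simp_all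
    obtain \<alpha> where \<alpha>: "z = cis \<alpha>" "0 < \<alpha>" "\<alpha> < pi" "key z = 2 - cos \<alpha>"
      by (rule key_gt_1[OF z gt(1)])
    obtain \<beta> where \<beta>: "w = cis \<beta>" "0 < \<beta>" "\<beta> < pi" "key w = 2 - cos \<beta>"
      by (rule key_gt_1[OF w gt(2)])
    have "\<alpha> = \<beta>"
      by (rule cos_inj_pi) (use \<alpha> \<beta> eq in simp_all)
    then show ?thesis
      using \<alpha>(1) \<beta>(1) by simp
  qed
qed

text \<open>With half difference \<delta> and half sum \<sigma> of the angles the expression is
  \<open>2 * sin \<delta> * (cos \<delta> - t * cos \<sigma>)\<close>. Since \<delta> is smaller
  than both \<sigma> and pi - \<sigma>, the cosine of \<delta> exceeds the absolute value of that of
  \<sigma>.\<close>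

lemma orient_diameter_arc_arc:
  fixes t \<alpha> \<beta> :: real
  assumes "-1 \<le> t" "t \<le> 1" "0 < \<alpha>" "\<alpha> < \<beta>" "\<beta> < pi"
  shows "0 < (cos \<alpha> - t) * sin \<beta> - sin \<alpha> * (cos \<beta> - t)"
proof -
  define \<delta> \<sigma> where "\<delta> = (\<beta> - \<alpha>) / 2" and "\<sigma> = (\<alpha> + \<beta>) / 2"
  have ab: "\<alpha> = \<sigma> - \<delta>" "\<beta> = \<sigma> + \<delta>"
    unfolding \<delta>_def \<sigma>_def by (auto simp: field_simps)
  have "cos \<sigma> < cos \<delta>" "cos (pi - \<sigma>) < cos \<delta>"
    using assms by (intro cos_monotone_0_pi; simp add: \<delta>_def \<sigma>_def field_simps)+
  then have "\<bar>cos \<sigma>\<bar> < cos \<delta>"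
    by (simp add: abs_less_iff)
  moreover have "\<bar>t * cos \<sigma>\<bar> \<le> 1 * \<bar>cos \<sigma>\<bar>"
    unfolding abs_mult using assms by (intro mult_right_mono) auto
  ultimately have "0 < cos \<delta> - t * cos \<sigma>"
    by linarith
  moreover have "0 < sin \<delta>"
    using assms by (intro sin_gt_zero) (auto simp: \<delta>_def)
  ultimately have "0 < 2 * sin \<delta> * (cos \<delta> - t * cos \<sigma>)"
    by simp
  also have "\<dots> = sin (\<beta> - \<alpha>) + t * (sin \<alpha> - sin \<beta>)"
  proof -
    have "\<beta> - \<alpha> = 2 * \<delta>"
      unfolding \<delta>_def by simp
    then have "sin (\<beta> - \<alpha>) = 2 * sin \<delta> * cos \<delta>"
      by (simp add: sin_double)
    moreover have "sin \<alpha> - sin \<beta> = - 2 * sin \<delta> * cos \<sigma>"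
      unfolding ab sin_add sin_diff by simp
    ultimately show ?thesis
      by (simp only: right_diff_distrib) (simp add: algebra_simps)
  qed
  also have "\<dots> = (cos \<alpha> - t) * sin \<beta> - sin \<alpha> * (cos \<beta> - t)"
    unfolding sin_diff by (simp add: algebra_simps)
  finally show ?thesis .
qed

text \<open>For a triangle inscribed in the unit circle the doubled area is four times the product
  of the sines of its angles, here \<open>u\<close>, \<open>v\<close> and pi - (u + v), which are
  half the arcs.\<close>

lemma orient_arc_arc_arc:
  fixes \<alpha> \<beta> \<gamma> :: real
  assumes "0 < \<alpha>" "\<alpha> < \<beta>" "\<beta> < \<gamma>" "\<gamma> < pi"
  shows "0 < (cos \<beta> - cos \<alpha>) * (sin \<gamma> - sin \<alpha>) - (sin \<beta> - sin \<alpha>) * (cos \<gamma> - cos \<alpha>)"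
proof -
  define u v where "u = (\<beta> - \<alpha>) / 2" and "v = (\<gamma> - \<beta>) / 2"
  have "0 < sin u" "0 < sin v" "0 < sin (u + v)"
    using assms by (intro sin_gt_zero; simp add: u_def v_def field_simps)+
  then have "0 < 4 * sin u * sin v * sin (u + v)"
    by simp
  also have "\<dots> = sin (2 * u) * (2 * (sin v)\<^sup>2) + sin (2 * v) * (2 * (sin u)\<^sup>2)"
    unfolding sin_double sin_add by (simp add: algebra_simps power2_eq_square)
  also have "\<dots> = sin (2 * u) * (1 - cos (2 * v)) + sin (2 * v) * (1 - cos (2 * u))"
    unfolding cos_double_sin by simp
  also have "\<dots> = sin (2 * u) + sin (2 * v) - sin (2 * u + 2 * v)"
    unfolding sin_add by (simp add: algebra_simps)
  also have "\<dots> = sin (\<beta> - \<alpha>) + sin (\<gamma> - \<beta>) - sin (\<gamma> - \<alpha>)"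
  proof -
    have "2 * u = \<beta> - \<alpha>" "2 * v = \<gamma> - \<beta>"
      unfolding u_def v_def by simp_all
    then show ?thesis
      by simp
  qed
  also have "\<dots> = (cos \<beta> - cos \<alpha>) * (sin \<gamma> - sin \<alpha>) - (sin \<beta> - sin \<alpha>) * (cos \<gamma> - cos \<alpha>)"
    unfolding sin_diff by (simp add: algebra_simps)
  finally show ?thesis .
qed

lemma cos_less_imp_greater:
  fixes \<alpha> \<beta> :: real
  assumes "0 < \<beta>" "\<alpha> < pi" "cos \<beta> < cos \<alpha>"
  shows "\<alpha> < \<beta>"
  using assms cos_monotone_0_pi_le[of \<beta> \<alpha>] by linarith

text \<open>Three distinct boundary points are collinear only if all are on the diameter. The
  condition on the last one, \<open>r\<close>, rules this out.\<close>

lemma orient_pos: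
  assumes H: "p \<in> half_disk_boundary" "q \<in> half_disk_boundary" "r \<in> half_disk_boundary"
    and less: "key p < key q" "key q < key r" "1 < key r"
  shows "0 < orient p q r"
  using H(3)
proof (cases rule: half_disk_boundary_cases)
  case 1
  then show ?thesis
    using less(3) by simp
next
  case r: (2 \<gamma>)
  show ?thesis
    using H(2)
  proof (cases rule: half_disk_boundary_cases)
    case q: (1 t)
    have "p = of_real (key p)"
      by (rule key_le_1[OF H(1)]) (use q less(1) in linarith)
    then have "Re p = key p" "Im p = 0"
      by (metis Re_complex_of_real Im_complex_of_real)+
    then show ?thesis
      using q r less(1) sin_gt_zero[of \<gamma>] by (simp add: orient_def)
  next
    case q: (2 \<beta>)
    have "\<beta> < \<gamma>"
      by (rule cos_less_imp_greater) (use q r less(2) in simp_all)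
    show ?thesis
      using H(1)
    proof (cases rule: half_disk_boundary_cases)
      case (1 t)
      then show ?thesis
        using orient_diameter_arc_arc[of t \<beta> \<gamma>] q r \<open>\<beta> < \<gamma>\<close> by (simp add: orient_def)
    next
      case p: (2 \<alpha>)
      have "\<alpha> < \<beta>"
        by (rule cos_less_imp_greater) (use p q less(1) in simp_all)
      then show ?thesis
        using orient_arc_arc_arc[of \<alpha> \<beta> \<gamma>] p r q \<open>\<beta> < \<gamma>\<close> by (simp add: orient_def)
    qed
  qed
qed

lemma orient_nonneg:
  assumes H: "p \<in> half_disk_boundary" "q \<in> half_disk_boundary" "r \<in> half_disk_boundary"
    and less: "key p < key q" "key q < key r"
  shows "0 \<le> orient p q r"
proof (cases "1 < key r")
  case True
  then show ?thesis
    using orient_pos[OF assms] by simp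
next
  case False
  have real: "Im z = 0" if "z \<in> half_disk_boundary" "key z \<le> 1" for z
    using that by (cases rule: half_disk_boundary_cases) auto
  have "Im p = 0" "Im q = 0" "Im r = 0"
    using False less H by (auto intro!: real)
  then show ?thesis
    by (simp add: orient_def)
qed

text \<open>The weights need not sum to one, so that signed areas can be inserted directly; dividing
  by the common total gives a common point of the hulls.\<close>

lemma convex_combination_meets:
  fixes a b c d :: complex
  assumes "a \<in> convex hull B" "c \<in> convex hull B" "b \<in> convex hull C" "d \<in> convex hull C"
    and w: "0 \<le> w1" "0 \<le> w2" "0 \<le> v1" "0 \<le> v2" "w1 + w2 = v1 + v2" "0 < v1 + v2"
    and eq: "of_real w1 * a + of_real w2 * c = of_real v1 * b + of_real v2 * d"
  shows "convex hull B \<inter> convex hull C \<noteq> {}"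
proof -
  define s where "s = v1 + v2"
  have s: "0 < s" "w1 / s + w2 / s = 1" "v1 / s + v2 / s = 1"
    using w by (auto simp: s_def simp flip: add_divide_distrib)
  have "(w1 / s) *\<^sub>R a + (w2 / s) *\<^sub>R c \<in> convex hull B"
    using assms s by (intro convexD) auto
  moreover have "(v1 / s) *\<^sub>R b + (v2 / s) *\<^sub>R d \<in> convex hull C"
    using assms s by (intro convexD) auto
  moreover have "(w1 / s) *\<^sub>R a + (w2 / s) *\<^sub>R c = (v1 / s) *\<^sub>R b + (v2 / s) *\<^sub>R d"
    using eq unfolding scaleR_conv_of_real of_real_divide times_divide_eq_left
    by (simp flip: add_divide_distrib)
  ultimately show ?thesis
    by auto
qed

text \<open>On the diameter the middle point \<open>b\<close> is itself a convex combination of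
  \<open>a\<close> and \<open>c\<close>. Otherwise \<open>a\<close>, \<open>b\<close>,
  \<open>c\<close>, \<open>d\<close> occur in this cyclic order on a convex curve, and the segments
  from \<open>a\<close> to \<open>c\<close> and from \<open>b\<close> to \<open>d\<close>
  meet.\<close>

lemma cross_hulls_meet:
  assumes H: "B \<subseteq> half_disk_boundary" "C \<subseteq> half_disk_boundary"
    and "cross 1 (key ` B) (key ` C)"
  shows "convex hull B \<inter> convex hull C \<noteq> {}"
proof -
  obtain a b c where abc: "a \<in> B" "b \<in> C" "c \<in> B" "key a < key b" "key b < key c"
    and d: "key c \<le> 1 \<or> (\<exists>d\<in>C. key c < key d)"
    using assms(3) unfolding cross_def by auto
  have hull: "a \<in> convex hull B" "b \<in> convex hull C" "c \<in> convex hull B"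
    using abc by (auto intro: hull_inc)
  have HH: "a \<in> half_disk_boundary" "b \<in> half_disk_boundary" "c \<in> half_disk_boundary"
    using abc H by auto
  show ?thesis
  proof (cases "key c \<le> 1")
    case True
    have "a = of_real (key a)" "b = of_real (key b)" "c = of_real (key c)"
      using HH True abc by (auto intro!: key_le_1)
    then have "Re a = key a" "Re b = key b" "Re c = key c" "Im a = 0" "Im b = 0" "Im c = 0"
      by (metis Re_complex_of_real Im_complex_of_real)+
    then have "of_real (key c - key b) * a + of_real (key b - key a) * c
        = of_real (key c - key a) * b + of_real 0 * b"
      by (simp add: complex_eq_iff algebra_simps)
    then show ?thesis
      using abc by (intro convex_combination_meets[OF hull(1,3,2,2),
            of "key c - key b" "key b - key a" "key c - key a" 0]) auto
  next
    case False
    then obtain d where d: "d \<in> C" "key c < key d"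
      using d by blast
    then have Hd: "d \<in> half_disk_boundary" and hd: "d \<in> convex hull C"
      using H by (auto intro: hull_inc)
    have "1 < key d"
      using False d by simp
    then have o: "0 < orient b c d" "0 < orient a b d" "0 < orient a c d" "0 \<le> orient a b c"
      using HH Hd abc d by (auto intro!: orient_pos orient_nonneg)
    text \<open>Radon's identity for four points of the plane.\<close>
    have "of_real (orient b c d) * a + of_real (orient a b d) * c
        = of_real (orient a c d) * b + of_real (orient a b c) * d"
      by (simp add: complex_eq_iff orient_def algebra_simps)
    moreover have "orient b c d + orient a b d = orient a c d + orient a b c"
      by (simp add: orient_def algebra_simps)
    ultimately show ?thesis
      using o by (intro convex_combination_meets[OF hull(1,3,2) hd,
            of "orient b c d" "orient a b d" "orient a c d" "orient a b c"]) auto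
  qed
qed

lemma orient_rotate: "orient p q r = orient q r p"
  by (simp add: orient_def algebra_simps)

lemma orient_swap: "orient q p r = - orient p q r"
  by (simp add: orient_def algebra_simps)

text \<open>The signed area is an affine function of its last argument, so its sign defines two half
  planes. The closed one is for the set that supplies \<open>p\<close> and \<open>q\<close>, the
  open one for the other set.\<close>

lemma orient_separates:
  assumes "\<And>b. b \<in> B \<Longrightarrow> 0 \<le> orient p q b" "\<And>c. c \<in> C \<Longrightarrow> orient p q c < 0"
  shows "convex hull B \<inter> convex hull C = {}"
proof -
  \<comment> \<open>The vector \<open>q - p\<close> after a quarter turn, normal to the
    line.\<close>
  define n where "n = Complex (Im p - Im q) (Re q - Re p)"
  have o: "orient p q x = n \<bullet> x - n \<bullet> p" for x
    by (simp add: orient_def n_def inner_complex_def algebra_simps)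
  have "convex hull B \<subseteq> {x. n \<bullet> p \<le> n \<bullet> x}"
    using assms(1) convex_halfspace_ge[of "n \<bullet> p" n] by (intro hull_minimal) (auto simp: o)
  moreover have "convex hull C \<subseteq> {x. n \<bullet> x < n \<bullet> p}"
    using assms(2) by (intro hull_minimal convex_halfspace_lt) (auto simp: o)
  ultimately show ?thesis
    by fastforce
qed

lemma finite_obtains_min:
  fixes f :: "'a \<Rightarrow> real"
  assumes "finite S" "S \<noteq> {}"
  obtains x where "x \<in> S" "\<And>y. y \<in> S \<Longrightarrow> f x \<le> f y"
proof -
  have "Min (f ` S) \<in> f ` S"
    using assms by (intro Min_in) auto
  then obtain x where "x \<in> S" "f x = Min (f ` S)"
    by auto
  then show ?thesis
    using that[of x] assms(1) by simp
qed

lemma finite_obtains_max: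
  fixes f :: "'a \<Rightarrow> real"
  assumes "finite S" "S \<noteq> {}"
  obtains x where "x \<in> S" "\<And>y. y \<in> S \<Longrightarrow> f y \<le> f x"
proof -
  have "Max (f ` S) \<in> f ` S"
    using assms by (intro Max_in) auto
  then obtain x where "x \<in> S" "f x = Max (f ` S)"
    by auto
  then show ?thesis
    using that[of x] assms(1) by simp
qed

text \<open>Without a crossing, \<open>C\<close> lies between two consecutive points of \<open>B\<close> or after all of them. A line
  through two extreme points of \<open>B\<close> or of \<open>C\<close> then separates the hulls.\<close>

lemma not_cross_hulls_disjoint_aux:
  assumes H: "B \<subseteq> half_disk_boundary" "C \<subseteq> half_disk_boundary"
    and fin: "finite B" "finite C" "C \<noteq> {}" and disj: "B \<inter> C = {}"
    and nc: "\<not> cross 1 (key ` B) (key ` C)"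
    and b0: "b0 \<in> B" "\<And>c. c \<in> C \<Longrightarrow> key b0 < key c"
  shows "convex hull B \<inter> convex hull C = {}"
proof -
  obtain c1 where c1: "c1 \<in> C" "\<And>c. c \<in> C \<Longrightarrow> key c1 \<le> key c"
    using finite_obtains_min[OF fin(2,3), where f = key] by blast
  obtain c2 where c2: "c2 \<in> C" "\<And>c. c \<in> C \<Longrightarrow> key c \<le> key c2"
    using finite_obtains_max[OF fin(2,3), where f = key] by blast
  have BH: "b \<in> half_disk_boundary" if "b \<in> B" for b
    using H that by blast
  have CH: "c \<in> half_disk_boundary" if "c \<in> C" for c
    using H that by blast
  have key_eq: "x = y" if "x \<in> B \<union> C" "y \<in> B \<union> C" "key x = key y" for x y
    using inj_onD[OF inj_on_key that(3)] that H by blast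
  have key_ne: "key b \<noteq> key c" if "b \<in> B" "c \<in> C" for b c
    using key_eq[of b c] that disj by blast
  \<comment> \<open>Otherwise the keys of \<open>b0\<close>, \<open>c1\<close>, \<open>b\<close>,
    \<open>c2\<close> would alternate between \<open>B\<close> and \<open>C\<close>.\<close>
  have outside: "key b < key c1 \<or> key c2 < key b" if b: "b \<in> B" for b
  proof (rule ccontr)
    assume "\<not> ?thesis"
    then have "key c1 < key b" "key b < key c2"
      using key_ne[OF b c1(1)] key_ne[OF b c2(1)] by auto
    then have "cross 1 (key ` B) (key ` C)"
      using b b0 c1 c2 by (intro crossI2[of "key b0" _ "key c1" _ "key b" "key c2"]) auto
    then show False
      using nc by simp
  qed
  show ?thesis
  proof (cases "\<exists>b\<in>B. key c2 < key b")
    case True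
    \<comment> \<open>\<open>C\<close> sits in one gap of \<open>B\<close>; \<open>b1\<close> and
      \<open>b2\<close> are the two ends of this gap, and the line through them will
      separate.\<close>
    obtain b1 where b1: "b1 \<in> {b \<in> B. key b < key c1}" "\<And>b. b \<in> {b \<in> B. key b < key c1} \<Longrightarrow> key b \<le> key b1"
      using finite_obtains_max[of "{b \<in> B. key b < key c1}" key] fin b0 c1(1) by auto
    obtain b2 where b2: "b2 \<in> {b \<in> B. key c2 < key b}" "\<And>b. b \<in> {b \<in> B. key c2 < key b} \<Longrightarrow> key b2 \<le> key b"
      using finite_obtains_min[of "{b \<in> B. key c2 < key b}" key] fin True by auto
    have c12: "key c1 \<le> key c2"
      using c1 c2 by blast
    \<comment> \<open>If \<open>b2\<close> were on the diameter, so would be \<open>c1\<close>,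
      between \<open>b1\<close> and \<open>b2\<close>, which is a crossing. With \<open>b2\<close>
      on the arc the points of \<open>C\<close> are strictly off the line.\<close>
    have "1 < key b2"
    proof (rule ccontr)
      assume "\<not> 1 < key b2"
      then have "cross 1 (key ` B) (key ` C)"
        using b1(1) b2(1) c1(1) c12 by (intro crossI1[of "key b1" _ "key c1" _ "key b2"]) auto
      then show False
        using nc by simp
    qed
    show ?thesis
    proof (rule orient_separates)
      fix b assume b: "b \<in> B"
      consider "b = b1" | "b = b2" | "key b < key b1" | "key b2 < key b"
        using outside[OF b] b1 b2 b key_eq[of b b1] key_eq[of b b2] by fastforce
      then show "0 \<le> orient b1 b2 b"
      proof cases
        case 3
        then have "0 \<le> orient b b1 b2"
          using b b1(1) b2(1) c12 BH by (intro orient_nonneg) auto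
        then show ?thesis
          by (metis orient_rotate)
      next
        case 4
        then show ?thesis
          using b b1(1) b2(1) c12 BH by (intro orient_nonneg) auto
      qed (simp_all add: orient_def)
    next
      fix c assume c: "c \<in> C"
      have "0 < orient b1 c b2"
        using c1(2)[OF c] c2(2)[OF c] b1(1) b2(1) BH CH[OF c] \<open>1 < key b2\<close> by (intro orient_pos) auto
      then show "orient b1 b2 c < 0"
        by (metis neg_less_0_iff_less orient_rotate orient_swap)
    qed
  next
    case False
    then have less: "key b < key c" if "b \<in> B" "c \<in> C" for b c
      using outside[OF that(1)] that c1(2)[OF that(2)] by force
    \<comment> \<open>Now all of \<open>B\<close> precedes \<open>C\<close>. If \<open>C\<close>
      ends on the diameter, everything is collinear and signed areas of the points vanish, so a
      transversal line is required. If \<open>C\<close> ends on the arc, the line goes through its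
      two extreme points, or, when \<open>C\<close> is a single point, through those of
      \<open>B\<close>.\<close>
    consider "key c2 \<le> 1" | "1 < key c2" "c1 \<noteq> c2" | "1 < key c2" "c1 = c2"
      by linarith
    then show ?thesis
    proof cases
      case 1
      have real: "Re z = key z" "Im z = 0" if "z \<in> B \<union> C" for z
      proof -
        have "key z \<le> 1"
          using that 1 less[OF _ c2(1)] c2(2) by fastforce
        then have "z = of_real (key z)"
          using that H by (intro key_le_1) auto
        then show "Re z = key z" "Im z = 0"
          by (metis Re_complex_of_real Im_complex_of_real)+
      qed
      text \<open>The vertical line through \<open>c1\<close>.\<close>
      have "convex hull C \<inter> convex hull B = {}"
      proof (rule orient_separates[where p = c1 and q = "c1 - \<i>"])
        show "0 \<le> orient c1 (c1 - \<i>) c" if "c \<in> C" for c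
          using that c1 real by (simp add: orient_def)
        show "orient c1 (c1 - \<i>) b < 0" if "b \<in> B" for b
          using that c1(1) real less[OF that c1(1)] by (simp add: orient_def)
      qed
      then show ?thesis
        by blast
    next
      case 2
      then have c12: "key c1 < key c2"
        using c1(2)[OF c2(1)] key_eq[of c1 c2] c1(1) c2(1) by fastforce
      have "convex hull C \<inter> convex hull B = {}"
      proof (rule orient_separates[where p = c2 and q = c1])
        fix c assume c: "c \<in> C"
        consider "c = c1" | "c = c2" | "key c1 < key c" "key c < key c2"
          using c1 c2 c key_eq[of c c1] key_eq[of c c2] by fastforce
        then show "0 \<le> orient c2 c1 c"
        proof cases
          case 3
          then have "0 \<le> orient c1 c c2"
            using c c1(1) c2(1) CH by (intro orient_nonneg) auto
          then show ?thesis
            by (metis orient_rotate)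
        qed (simp_all add: orient_def)
      next
        fix b assume b: "b \<in> B"
        have "0 < orient b c1 c2"
          using 2(1) c12 less[OF b c1(1)] BH[OF b] CH c1(1) c2(1) by (intro orient_pos) auto
        then show "orient c2 c1 b < 0"
          by (metis neg_less_0_iff_less orient_rotate orient_swap)
      qed
      then show ?thesis
        by blast
    next
      case 3
      have C: "C = {c2}"
      proof -
        have "c = c2" if "c \<in> C" for c
          using c1(2)[OF that] c2(2)[OF that] key_eq[of c c2] that c2(1) 3(2) by simp
        then show ?thesis
          using c2(1) by blast
      qed
      obtain b1 where b1: "b1 \<in> B" "\<And>b. b \<in> B \<Longrightarrow> key b1 \<le> key b"
        using finite_obtains_min[OF fin(1), of key] b0 by blast
      obtain b2 where b2: "b2 \<in> B" "\<And>b. b \<in> B \<Longrightarrow> key b \<le> key b2"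
        using finite_obtains_max[OF fin(1), of key] b0 by blast
      show ?thesis
      proof (cases "b1 = b2")
        case True
        have "b = b1" if "b \<in> B" for b
          using key_eq[of b b1] that b1 b2 True by (metis UnCI antisym)
        then have "B = {b1}"
          using b1(1) by blast
        then show ?thesis
          using C disj by simp
      next
        case False
        then have b12: "key b1 < key b2"
          using b1(2)[OF b2(1)] key_eq[of b1 b2] b1(1) b2(1) by fastforce
        show ?thesis
        proof (rule orient_separates[where p = b2 and q = b1])
          fix b assume b: "b \<in> B"
          consider "b = b1" | "b = b2" | "key b1 < key b" "key b < key b2"
            using b1 b2 b key_eq[of b b1] key_eq[of b b2] by fastforce
          then show "0 \<le> orient b2 b1 b"
          proof cases
            case 3
            then have "0 \<le> orient b1 b b2"
              using b b1(1) b2(1) BH by (intro orient_nonneg) auto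
            then show ?thesis
              by (metis orient_rotate)
          qed (simp_all add: orient_def)
        next
          fix c assume c: "c \<in> C"
          have "0 < orient b1 b2 c"
            using 3(1) C c b12 less[OF b2(1) c] BH b1(1) b2(1) CH[OF c] by (intro orient_pos) auto
          then show "orient b2 b1 c < 0"
            by (metis neg_less_0_iff_less orient_swap)
        qed
      qed
    qed
  qed
qed

text \<open>The argument for a block that starts first applies to whichever of the two contains the
  smallest key.\<close>

lemma not_cross_hulls_disjoint:
  assumes H: "B \<subseteq> half_disk_boundary" "C \<subseteq> half_disk_boundary"
    and fin: "finite B" "finite C" "B \<noteq> {}" "C \<noteq> {}" and disj: "B \<inter> C = {}"
    and nc: "\<not> cross 1 (key ` B) (key ` C)" "\<not> cross 1 (key ` C) (key ` B)"
  shows "convex hull B \<inter> convex hull C = {}"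
proof -
  obtain b0 where b0: "b0 \<in> B" "\<And>b. b \<in> B \<Longrightarrow> key b0 \<le> key b"
    using finite_obtains_min[OF fin(1,3), of key] by blast
  obtain c0 where c0: "c0 \<in> C" "\<And>c. c \<in> C \<Longrightarrow> key c0 \<le> key c"
    using finite_obtains_min[OF fin(2,4), of key] by blast
  have "key b0 \<noteq> key c0"
    using inj_onD[OF inj_on_key, of b0 c0] b0(1) c0(1) H disj by blast
  then consider "key b0 < key c0" | "key c0 < key b0"
    by linarith
  then show ?thesis
  proof cases
    case 1
    then show ?thesis
      using not_cross_hulls_disjoint_aux[OF H fin(1,2,4) disj nc(1) b0(1)] c0(2) by fastforce
  next
    case 2
    have "convex hull C \<inter> convex hull B = {}"
      using not_cross_hulls_disjoint_aux[OF H(2,1) fin(2,1,3) _ nc(2) c0(1)] disj b0(2) 2 by fastforce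
    then show ?thesis
      by blast
  qed
qed

section \<open>Transfer to noncrossing partitions of points\<close>

lemma partition_on_image:
  assumes "partition_on A P" "inj_on f A"
  shows "partition_on (f ` A) ((`) f ` P)"
proof -
  have "{} \<notin> (`) f ` P"
    using partition_onD3[OF assms(1)] by auto
  then show ?thesis
    using partition_on_inj_image[OF assms] by simp
qed

text \<open>\<open>key\<close> is injective on the boundary and translates disjointness of hulls
  into absence of crossings in both directions, so partitions correspond block by block.\<close>

lemma scd_NC:
  assumes P: "P \<subseteq> half_disk_boundary" "finite P" "P \<noteq> {}"
  shows "scd (NC P) nc_le (nc_rank P) (int (card P) - 1)"
proof -
  define g where "g = inv_into P key"
  have inj: "inj_on key P"
    using inj_on_key P(1) by (rule inj_on_subset)
  have kg: "key (g x) = x" if "x \<in> key ` P" for x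
    using that unfolding g_def by (rule f_inv_into_f)
  have gk: "g (key z) = z" if "z \<in> P" for z
    unfolding g_def using inj that by (rule inv_into_f_f)
  have kgB: "key ` g ` B = B" if "B \<subseteq> key ` P" for B
    using that kg by (force simp: image_image)
  have gkB: "g ` key ` B = B" if "B \<subseteq> P" for B
    using that gk by (force simp: image_image)
  have inj_g: "inj_on g (key ` P)"
    unfolding g_def by (rule inj_on_inv_into) simp
  have gP: "g ` key ` P = P"
    using order_refl by (rule gkB)
  have part_g: "partition_on P ((`) g ` \<pi>)" if "partition_on (key ` P) \<pi>" for \<pi>
    using partition_on_image[OF that inj_g] unfolding gP .
  have bij: "bij_betw ((`) ((`) g)) (ncs 1 (key ` P)) (NC P)"
  proof (rule bij_betw_byWitness[where f' = "(`) ((`) key)"])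
    show "\<forall>\<pi>\<in>ncs 1 (key ` P). (`) key ` (`) g ` \<pi> = \<pi>"
    proof
      fix \<pi> assume \<pi>: "\<pi> \<in> ncs 1 (key ` P)"
      have "(\<lambda>B. key ` g ` B) ` \<pi> = (\<lambda>B. B) ` \<pi>"
        by (rule image_cong[OF refl kgB[OF ncs_block_subset[OF \<pi>]]])
      then show "(`) key ` (`) g ` \<pi> = \<pi>"
        unfolding image_image[of "(`) key" "(`) g"] by simp
    qed
    show "\<forall>\<pi>\<in>NC P. (`) g ` (`) key ` \<pi> = \<pi>"
    proof
      fix \<pi> assume "\<pi> \<in> NC P"
      then have \<pi>: "B \<subseteq> P" if "B \<in> \<pi>" for B
        using that unfolding NC_def partition_on_def by auto
      have "(\<lambda>B. g ` key ` B) ` \<pi> = (\<lambda>B. B) ` \<pi>"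
        by (rule image_cong[OF refl gkB[OF \<pi>]])
      then show "(`) g ` (`) key ` \<pi> = \<pi>"
        unfolding image_image[of "(`) g" "(`) key"] by simp
    qed
    show "(`) ((`) g) ` ncs 1 (key ` P) \<subseteq> NC P"
    proof
      fix \<mu> assume "\<mu> \<in> (`) ((`) g) ` ncs 1 (key ` P)"
      then obtain \<pi> where \<pi>: "\<pi> \<in> ncs 1 (key ` P)" "\<mu> = (`) g ` \<pi>"
        by (rule imageE)
      have p: "partition_on P \<mu>"
        unfolding \<pi>(2) using ncs_partition[OF \<pi>(1)] by (rule part_g)
      have "convex hull B' \<inter> convex hull C' = {}" if BC': "B' \<in> \<mu>" "C' \<in> \<mu>" "B' \<noteq> C'" for B' C'
      proof -
        obtain B C where BC: "B \<in> \<pi>" "B' = g ` B" "C \<in> \<pi>" "C' = g ` C"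
          using BC'(1,2) unfolding \<pi>(2) by (elim imageE)
        then have "B \<noteq> C"
          using BC'(3) by blast
        have k: "key ` B' = B" "key ` C' = C"
          using kgB ncs_block_subset[OF \<pi>(1)] BC by simp_all
        have sub: "B' \<subseteq> P" "C' \<subseteq> P"
          using BC' partition_onD1[OF p] by auto
        show ?thesis
        proof (rule not_cross_hulls_disjoint)
          show "B' \<subseteq> half_disk_boundary" "C' \<subseteq> half_disk_boundary" "finite B'" "finite C'"
            using sub P finite_subset by blast+
          show "B' \<noteq> {}" "C' \<noteq> {}"
            using BC' partition_onD3[OF p] by blast+
          show "B' \<inter> C' = {}"
            using BC' partition_onD2[OF p] by (auto dest: disjointD)
          show "\<not> cross 1 (key ` B') (key ` C')" "\<not> cross 1 (key ` C') (key ` B')"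
            unfolding k using ncs_not_cross[OF \<pi>(1)] BC \<open>B \<noteq> C\<close> by auto
        qed
      qed
      then show "\<mu> \<in> NC P"
        using p unfolding NC_def disjoint_family_on_def by blast
    qed
    show "(`) ((`) key) ` NC P \<subseteq> ncs 1 (key ` P)"
    proof
      fix \<mu> assume "\<mu> \<in> (`) ((`) key) ` NC P"
      then obtain \<pi> where \<pi>: "\<pi> \<in> NC P" "\<mu> = (`) key ` \<pi>"
        by (rule imageE)
      have p: "partition_on P \<pi>" and d: "\<And>B C. B \<in> \<pi> \<Longrightarrow> C \<in> \<pi> \<Longrightarrow> B \<noteq> C \<Longrightarrow> convex hull B \<inter> convex hull C = {}"
        using \<pi>(1) unfolding NC_def disjoint_family_on_def by auto
      have "\<not> cross 1 (key ` B) (key ` C)" if "B \<in> \<pi>" "C \<in> \<pi>" "key ` B \<noteq> key ` C" for B C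
      proof -
        have "B \<subseteq> half_disk_boundary" "C \<subseteq> half_disk_boundary"
          using that partition_onD1[OF p] P(1) by auto
        then show ?thesis
          using cross_hulls_meet[of B C] d[OF that(1,2)] that(3) by blast
      qed
      then show "\<mu> \<in> ncs 1 (key ` P)"
        unfolding ncs_def \<pi>(2) using partition_on_image[OF p inj] by auto
    qed
  qed
  \<comment> \<open>The bound \<open>k = 1\<close> is the key of the right end of the diameter: arc
    points have keys above 1.\<close>
  have ncs: "scd (ncs 1 (key ` P)) below (\<lambda>\<pi>. - int (card \<pi>)) (- int (card P) - 1)"
    using scd_ncs[of "key ` P" 1] P card_image[OF inj] by simp
  have mono: "nc_le ((`) g ` \<pi>) ((`) g ` \<mu>)"
    if *: "\<pi> \<in> ncs 1 (key ` P)" "\<mu> \<in> ncs 1 (key ` P)" "below \<pi> \<mu>" for \<pi> \<mu>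
  proof -
    have p: "partition_on P ((`) g ` \<pi>)" "partition_on P ((`) g ` \<mu>)"
      using part_g[OF ncs_partition[OF *(1)]] part_g[OF ncs_partition[OF *(2)]] .
    have "\<exists>Y\<in>(`) g ` \<mu>. X \<subseteq> Y" if X: "X \<in> (`) g ` \<pi>" for X
    proof -
      obtain B where B: "B \<in> \<pi>" "X = g ` B"
        using X by (rule imageE)
      obtain C where C: "C \<in> \<mu>" "B \<subseteq> C"
        using *(3) B(1) unfolding below_def by blast
      show ?thesis
        unfolding B(2) using image_mono[OF C(2)] imageI[OF C(1)] by (rule bexI)
    qed
    then have "refines P ((`) g ` \<pi>) ((`) g ` \<mu>)"
      unfolding refines_def using p by blast
    then show ?thesis
      by (rule iffD2[OF nc_le_iff_refines[OF p]])
  qed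
  have rank: "nc_rank P ((`) g ` \<pi>) = - int (card \<pi>) + int (card P)" if *: "\<pi> \<in> ncs 1 (key ` P)" for \<pi>
  proof -
    have "inj_on ((`) g) \<pi>"
    proof (rule inj_onI)
      fix B C assume "B \<in> \<pi>" "C \<in> \<pi>" "g ` B = g ` C"
      then show "B = C"
        using inj_on_image_eq_iff[OF inj_g ncs_block_subset[OF *] ncs_block_subset[OF *], of B C] by simp
    qed
    then show ?thesis
      by (simp add: nc_rank_def card_image)
  qed
  \<comment> \<open>Passing from minus the number of blocks to \<open>nc_rank\<close> adds |P| to
    each rank, hence 2|P| to the centre, which becomes |P| - 1.\<close>
  have "scd (NC P) nc_le (nc_rank P) (- int (card P) - 1 + 2 * int (card P))"
    using ncs bij mono rank by (rule scd_image)
  then show ?thesis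
    by simp
qed

section \<open>From rank steps to saturated centered chains\<close>

text \<open>Sending each block of \<open>P\<close> to the block of \<open>Q\<close> around it is
  onto. With equally many blocks it would be injective, so each block of \<open>Q\<close> would
  consist of a single block of \<open>P\<close>, making the partitions equal.\<close>

lemma refines_card_less:
  assumes fin: "finite A" and r: "refines A P Q" and ne: "P \<noteq> Q"
  shows "card Q < card P"
proof -
  have p: "partition_on A P" "partition_on A Q" and sub: "\<And>X. X \<in> P \<Longrightarrow> \<exists>Y\<in>Q. X \<subseteq> Y"
    using r unfolding refines_def by blast+
  have finP: "finite P"
    using fin p(1) by (rule finite_elements)
  have "\<forall>X\<in>P. \<exists>Y. Y \<in> Q \<and> X \<subseteq> Y"
    using sub by blast
  from bchoice[OF this] obtain f where "\<forall>X\<in>P. f X \<in> Q \<and> X \<subseteq> f X"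
    by (rule exE)
  then have f: "f X \<in> Q \<and> X \<subseteq> f X" if "X \<in> P" for X
    using that by (rule bspec)
  have blocks: "\<exists>X\<in>P. x \<in> X \<and> f X = Y" if Y: "Y \<in> Q" "x \<in> Y" for x Y
  proof -
    have "x \<in> A"
      using Y partition_onD1[OF p(2)] by blast
    then obtain X where X: "X \<in> P" "x \<in> X"
      using partition_on_obtain_block[OF p(1)] by blast
    then have "f X = Y"
      using partition_on_same_block[OF p(2), of "f X" Y x] f[OF X(1)] Y by blast
    then show ?thesis
      using X by blast
  qed
  have surj: "f ` P = Q"
  proof
    show "f ` P \<subseteq> Q"
      using f by blast
    show "Q \<subseteq> f ` P"
    proof
      fix Y assume Y: "Y \<in> Q"
      then obtain x where "x \<in> Y"
        using partition_onD3[OF p(2)] by (metis ex_in_conv)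
      then show "Y \<in> f ` P"
        using blocks[OF Y] by blast
    qed
  qed
  then have "card Q \<le> card P"
    using card_image_le[OF finP] by blast
  moreover have "card Q \<noteq> card P"
  proof
    assume eq: "card Q = card P"
    then have inj: "inj_on f P"
      using surj finP by (simp add: eq_card_imp_inj_on)
    have "f X = X" if X: "X \<in> P" for X
    proof
      show "X \<subseteq> f X"
        using f[OF X] by blast
      show "f X \<subseteq> X"
      proof
        fix x assume "x \<in> f X"
        then obtain X' where "X' \<in> P" "x \<in> X'" "f X' = f X"
          using blocks f[OF X] by blast
        then show "x \<in> X"
          using inj X unfolding inj_on_def by blast
      qed
    qed
    then show False
      using surj ne by simp
  qed
  ultimately show ?thesis
    by simp
qed

lemma NC_refines:
  assumes "\<pi> \<in> NC P" "\<mu> \<in> NC P"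
  shows "nc_le \<pi> \<mu> \<longleftrightarrow> refines P \<pi> \<mu>"
  using assms by (intro nc_le_iff_refines) (auto simp: NC_def)

lemma nc_less_rank:
  assumes "finite P" "\<pi> \<in> NC P" "\<mu> \<in> NC P" "nc_less \<pi> \<mu>"
  shows "nc_rank P \<pi> < nc_rank P \<mu>"
proof -
  have "card \<mu> < card \<pi>"
    using assms refines_card_less[of P \<pi> \<mu>] NC_refines[of \<pi> P \<mu>] unfolding nc_less_def by blast
  then show ?thesis
    by (simp add: nc_rank_def)
qed

lemma nc_less_trans:
  assumes "\<pi> \<in> NC P" "\<mu> \<in> NC P" "\<nu> \<in> NC P" "nc_less \<pi> \<mu>" "nc_less \<mu> \<nu>"
  shows "nc_less \<pi> \<nu>"
proof -
  have r: "refines P \<pi> \<mu>" "refines P \<mu> \<nu>" "\<pi> \<noteq> \<mu>"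
    using assms NC_refines unfolding nc_less_def by blast+
  then have "refines P \<pi> \<nu>" "\<pi> \<noteq> \<nu>"
    using refines_trans refines_asym by blast+
  then show ?thesis
    using assms NC_refines unfolding nc_less_def by blast
qed

text \<open>Ranks are integers and strictly monotone, so nothing fits strictly between comparable
  partitions whose ranks differ by one: each step of the chain is a cover.\<close>

lemma symmetric_chain_saturated_centered:
  assumes P: "finite P" and C: "C \<subseteq> NC P"
    and ch: "symmetric_chain nc_le (nc_rank P) (int (card P) - 1) C"
  shows "\<exists>cs. set cs = C \<and> saturated P cs \<and> centered P cs"
proof -
  obtain cs where cs: "cs \<noteq> []" "set cs = C"
    "successively (\<lambda>x y. nc_le x y \<and> nc_rank P y = nc_rank P x + 1) cs"
    "nc_rank P (hd cs) + nc_rank P (last cs) = int (card P) - 1"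
    using ch by (rule symmetric_chainE)
  have covers: "nc_covers P x y"
    if xy: "x \<in> NC P" "y \<in> NC P" "nc_le x y" "nc_rank P y = nc_rank P x + 1" for x y
  proof -
    have "nc_less x y"
      using xy unfolding nc_less_def by auto
    moreover have "\<not> (nc_less x z \<and> nc_less z y)" if "z \<in> NC P" for z
      using nc_less_rank[OF P xy(1) that] nc_less_rank[OF P that xy(2)] xy(4) by linarith
    ultimately show ?thesis
      using xy unfolding nc_covers_def by blast
  qed
  have s: "successively (nc_covers P) cs"
    by (rule successively_mono[OF cs(3)]) (use covers cs(2) C in blast)
  have "successively nc_less cs"
    by (rule successively_mono[OF s]) (simp add: nc_covers_def)
  \<comment> \<open>Transitivity of \<open>nc_less\<close> is available for members of
    \<open>NC P\<close>, so the equivalence is taken in the form that asks for it on the list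
    entries alone.\<close>
  moreover have "successively nc_less cs \<longleftrightarrow> sorted_wrt nc_less cs"
    by (rule successively_iff_sorted_wrt_strong) (use nc_less_trans cs(2) C in blast)
  ultimately have "nc_chain P cs"
    using cs(1,2) C unfolding nc_chain_def by blast
  then show ?thesis
    using s cs(2,4) unfolding saturated_def centered_def by blast
qed

theorem theorem4p2:
  fixes m n :: nat and A U :: "complex set"
  assumes "A \<subseteq> closed_segment (-1) 1" and "-1 \<in> A" and "1 \<in> A"
    and "finite A" and "card A = m + 2"
    and "U \<subseteq> {cis \<theta> | \<theta>. 0 < \<theta> \<and> \<theta> < pi}"
    and "finite U" and "card U = n"
  shows "\<exists>\<D>. symmetric_chain_decomposition (A \<union> U) \<D>"
proof -
  let ?P = "A \<union> U"
  have P: "?P \<subseteq> half_disk_boundary" "finite ?P" "?P \<noteq> {}"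
    using assms unfolding half_disk_boundary_def by auto
  obtain D where D: "partition_on (NC ?P) D"
    "\<And>C. C \<in> D \<Longrightarrow> symmetric_chain nc_le (nc_rank ?P) (int (card ?P) - 1) C"
    by (rule scdE[OF scd_NC[OF P]], rule that)
  have "\<exists>cs. set cs = C \<and> saturated ?P cs \<and> centered ?P cs" if "C \<in> D" for C
    using partition_onD1[OF D(1)] that by (intro symmetric_chain_saturated_centered P(2) D(2)) auto
  then have "symmetric_chain_decomposition ?P D"
    using D(1) unfolding symmetric_chain_decomposition_def by blast
  then show ?thesis
    by blast
qed

end
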